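(* Let $K\subset\mathbb{R}^2$ be a compact convex set of area $F$ with boundary of class $\mathcal{C}^2$, having the origin as an interior point. Let $f$ be an anti $\pi$-periodic continuous function on $\mathbb{R}$ such that $f(x)=f(-x)$, and $H$ a $\mathcal{C}^2$ function on $[0,\pi]$ with $H''(x)=f(x)\sin(x)$, $x\in[0,\pi]$, and $H(0)=H'(0)=0$. Then $$\int_{G_i\cap K\neq\emptyset}f(\varphi_2-\varphi_1)\,dG_1\,dG_2=2\bigl(4H(\pi/2)-H(\pi)\bigr)F+2\int_{P\notin K}\bigl(2H(\omega_1)+2H(\omega_2)-H(\omega)\bigr)\,dP.$$
   Context: Anti $\pi$-periodic means $f(x+\pi)=-f(x)$ for all $x$. A line $G\subset\mathbb{R}^2$ not passing through the origin $O$ is given coordinates $(p,\varphi)$, $p>0$, $0\le\varphi<2\pi$, which are the polar coordinates of the point of $G$ at minimum distance from $O$ (lines through $O$ form a null set and are disregarded). $dG=dp\,d\varphi$, and ordered pairs of lines $(G_1,G_2)$, with coordinates $(p_i,\varphi_i)$, carry the measure $dG_1\,dG_2=dp_1\,d\varphi_1\,dp_2\,d\varphi_2$. The integral over $G_i\cap K\neq\emptyset$ is over all ordered pairs $(G_1,G_2)$ such that both $G_1$ and $G_2$ meet $K$. $dP$ is the area element of the plane. Direction of a line through a point $P\neq O$: let $\vec u$ be the unit vector orthogonal to $\overrightarrow{OP}$ such that the basis $(\vec u,\overrightarrow{OP})$ is positively oriented; for a line $G$ through $P$ (other than the one directed by $\vec u$) with unit director vector $\vec v$ chosen so that $(\vec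 u,\vec v)$ is positively oriented, the direction $\alpha(G)\in(0,\pi)$ is defined by $\cos\alpha=\vec u\cdot\vec v$. For $P\notin K$ the two support lines of $K$ through $P$ have directions $\alpha,\beta$ with $0<\alpha<\pi/2<\beta<\pi$. The visual angle of $K$ from $P$ is $\omega=\omega(P)=\beta-\alpha$, and one sets $\omega_1=\pi/2-\alpha$, $\omega_2=\beta-\pi/2$, so that $\omega=\omega_1+\omega_2$ (the line $OP$ splits the visual angle into $\omega_1$ and $\omega_2$).
   Formalization: The claim 0<α<π/2<β<π fails for points near the boundary of a non-centred disc; α, β are instead measured via the half-lines from P touching K, in (-π/2,π/2) and (π/2,3π/2), so that ω is the true visual angle, split by OP into ω₁, ω₂. *)

theory Defs
  imports "HOL-Analysis.Analysis"
begin

section \<open>Functions and boundaries of class \<open>C\<^sup>2\<close>\<close>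

text \<open>\<open>g1\<close> and \<open>g2\<close> are the first two derivatives of \<open>g\<close> on \<open>S\<close>; on a compact interval the
  derivatives at the end points are one-sided.\<close>

definition C2_on :: "real set \<Rightarrow> (real \<Rightarrow> 'a::real_normed_vector) \<Rightarrow> (real \<Rightarrow> 'a) \<Rightarrow> (real \<Rightarrow> 'a) \<Rightarrow> bool"
  where "C2_on S g g1 g2 \<longleftrightarrow>
    (\<forall>t\<in>S. (g has_vector_derivative g1 t) (at t within S)) \<and>
    (\<forall>t\<in>S. (g1 has_vector_derivative g2 t) (at t within S)) \<and>
    continuous_on S g2"

text \<open>The boundary is a regular simple closed curve of class \<open>C\<^sup>2\<close>; it is parametrised
  periodically over the whole line so that it also closes up in a \<open>C\<^sup>2\<close> way.\<close>

definition C2_boundary :: "(real^2) set \<Rightarrow> bool"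
  where "C2_boundary K \<longleftrightarrow>
    (\<exists>\<gamma> \<gamma>1 \<gamma>2 L. 0 < L \<and> C2_on UNIV \<gamma> \<gamma>1 \<gamma>2 \<and> (\<forall>t. \<gamma>1 t \<noteq> 0) \<and>
       (\<forall>t. \<gamma> (t + L) = \<gamma> t) \<and> inj_on \<gamma> {0..<L} \<and> range \<gamma> = frontier K)"


section \<open>Lines\<close>

definition line :: "real \<Rightarrow> real \<Rightarrow> (real^2) set"
  where "line p \<phi> = {x. x $ 1 * cos \<phi> + x $ 2 * sin \<phi> = p}"

text \<open>\<open>(p, \<phi>)\<close> are the polar coordinates of the point of the line closest to the origin.\<close>

lemma closest_point_line: "closest_point (line p \<phi>) 0 = vector [p * cos \<phi>, p * sin \<phi>]"
proof -
  have eq: "line p \<phi> = {x. (vector [cos \<phi>, sin \<phi>] :: real^2) \<bullet> x = p}"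
    by (auto simp: line_def inner_vec_def sum_2 mult.commute)
  have "vector [p * cos \<phi>, p * sin \<phi>] \<in> line p \<phi>"
    by (simp add: line_def mult.assoc flip: distrib_left power2_eq_square)
  moreover have "dist 0 (vector [p * cos \<phi>, p * sin \<phi>] :: real^2) \<le> dist 0 z"
    if "z \<in> line p \<phi>" for z
  proof -
    have 1: "norm (vector [p * cos \<phi>, p * sin \<phi>] :: real^2) = \<bar>p\<bar>"
      by (simp add: norm_vec_def L2_set_def sum_2 power_mult_distrib flip: distrib_left)
    have 2: "norm (vector [cos \<phi>, sin \<phi>] :: real^2) = 1"
      by (simp add: norm_vec_def L2_set_def sum_2)
    have "\<bar>p\<bar> \<le> norm (vector [cos \<phi>, sin \<phi>] :: real^2) * norm z"
      using that Cauchy_Schwarz_ineq2[of "vector [cos \<phi>, sin \<phi>] :: real^2" z] by (simp add: eq)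
    then show ?thesis using 1 2 by simp
  qed
  moreover have "convex (line p \<phi>)" "closed (line p \<phi>)"
    unfolding eq by (rule convex_hyperplane, rule closed_hyperplane)
  ultimately show ?thesis
    by (metis closest_point_unique)
qed

text \<open>Coordinates of the lines (not through the origin) that meet \<open>K\<close>.\<close>

definition lines_meeting :: "(real^2) set \<Rightarrow> (real \<times> real) set"
  where "lines_meeting K =
    {(p, \<phi>). 0 < p \<and> 0 \<le> \<phi> \<and> \<phi> < 2 * pi \<and> line p \<phi> \<inter> K \<noteq> {}}"

definition line_through :: "real^2 \<Rightarrow> real^2 \<Rightarrow> (real^2) set"
  where "line_through P v = range (\<lambda>t. P + t *\<^sub>R v)"

definition support_line :: "(real^2) set \<Rightarrow> (real^2) set \<Rightarrow> bool"
  where "support_line K G \<longleftrightarrow>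
    (\<exists>n c. n \<noteq> 0 \<and> G = {x. n \<bullet> x = c} \<and> K \<subseteq> {x. n \<bullet> x \<le> c} \<and> G \<inter> K \<noteq> {})"


section \<open>Directions of lines through a point\<close>

definition pos_oriented :: "real^2 \<Rightarrow> real^2 \<Rightarrow> bool"
  where "pos_oriented u v \<longleftrightarrow> det (vector [u, v] :: real^2^2) > 0"

text \<open>The unit vector \<open>u\<close> orthogonal to \<open>P\<close> for which \<open>(u, P)\<close> is positively oriented.\<close>

definition ref_dir :: "real^2 \<Rightarrow> real^2"
  where "ref_dir P = (1 / norm P) *\<^sub>R vector [P $ 2, - P $ 1]"

lemma pos_oriented_iff: "pos_oriented u v \<longleftrightarrow> u $ 1 * v $ 2 - u $ 2 * v $ 1 > 0"
  by (simp add: pos_oriented_def det_2)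

lemma norm_sq_2: "(norm (x::real^2))\<^sup>2 = (x $ 1)\<^sup>2 + (x $ 2)\<^sup>2"
  by (simp add: norm_vec_def L2_set_def sum_2)

lemma inner_2': "(x::real^2) \<bullet> y = x $ 1 * y $ 1 + x $ 2 * y $ 2"
  by (simp add: inner_vec_def sum_2)

lemma normalised_nth:
  assumes "P \<noteq> 0"
  shows "(P $ 1 / norm P) * (P $ 1 / norm P) + (P $ 2 / norm P) * (P $ 2 / norm (P::real^2)) = 1"
proof -
  have "(P $ 1 / norm P) * (P $ 1 / norm P) + (P $ 2 / norm P) * (P $ 2 / norm P)
      = (P $ 1 * P $ 1 + P $ 2 * P $ 2) / (norm P * norm P)"
    by (simp add: add_divide_distrib)
  also have "\<dots> = (norm P * norm P) / (norm P * norm P)"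
    using norm_sq_2[of P] by (simp add: power2_eq_square)
  finally show ?thesis using assms by simp
qed

lemma ref_dir_iff:
  assumes "P \<noteq> 0"
  shows "u = ref_dir P \<longleftrightarrow> norm u = 1 \<and> u \<bullet> P = 0 \<and> pos_oriented u P"
proof
  have N: "norm P > 0" "norm P * norm P = P $ 1 * P $ 1 + P $ 2 * P $ 2"
    using assms norm_sq_2[of P] by (auto simp: power2_eq_square)
  {
    assume u: "u = ref_dir P"
    have c: "u $ 1 = P $ 2 / norm P" "u $ 2 = - P $ 1 / norm P"
      by (simp_all add: u ref_dir_def)
    have "(norm u)\<^sup>2 = 1"
      using normalised_nth[OF assms] unfolding norm_sq_2 c by (simp add: power2_eq_square)
    then have "norm u = 1"
      using power2_eq_1_iff[of "norm u"] norm_ge_zero[of u] by linarith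
    moreover have "u \<bullet> P = 0"
      unfolding inner_2' c by simp
    moreover have "pos_oriented u P"
    proof -
      have "P $ 2 / norm P * P $ 2 - - P $ 1 / norm P * P $ 1 = norm P * norm P / norm P"
        unfolding N(2) by (simp add: add_divide_distrib)
      then show ?thesis unfolding pos_oriented_iff c using N(1) by simp
    qed
    ultimately show "norm u = 1 \<and> u \<bullet> P = 0 \<and> pos_oriented u P" by blast
  }
  {
    assume *: "norm u = 1 \<and> u \<bullet> P = 0 \<and> pos_oriented u P"
    define d where "d = u $ 1 * P $ 2 - u $ 2 * P $ 1"
    have o: "u $ 1 * P $ 1 + u $ 2 * P $ 2 = 0" and d: "d > 0"
      and n: "u $ 1 * u $ 1 + u $ 2 * u $ 2 = 1"
      using * norm_sq_2[of u] by (auto simp: inner_2' pos_oriented_iff d_def power2_eq_square)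
    have "d\<^sup>2 + (u $ 1 * P $ 1 + u $ 2 * P $ 2)\<^sup>2 =
        (u $ 1 * u $ 1 + u $ 2 * u $ 2) * (P $ 1 * P $ 1 + P $ 2 * P $ 2)"
      unfolding d_def by algebra
    then have "d\<^sup>2 = (norm P)\<^sup>2"
      using o n N by (simp add: power2_eq_square)
    then have dN: "d = norm P" using d by (simp add: power2_eq_iff_nonneg)
    have "u $ 1 * d = P $ 2" "u $ 2 * d = - P $ 1"
      unfolding d_def using o n by algebra+
    then have "u $ 1 = P $ 2 / norm P" "u $ 2 = - P $ 1 / norm P"
      using dN N(1) by (simp_all add: field_simps)
    then show "u = ref_dir P"
      by (simp add: vec_eq_iff forall_2 ref_dir_def)
  }
qed

definition has_direction :: "real^2 \<Rightarrow> (real^2) set \<Rightarrow> real \<Rightarrow> bool"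
  where "has_direction P G \<alpha> \<longleftrightarrow> 0 < \<alpha> \<and> \<alpha> < pi \<and>
    (\<exists>v. norm v = 1 \<and> G = line_through P v \<and> pos_oriented (ref_dir P) v \<and> cos \<alpha> = ref_dir P \<bullet> v)"


section \<open>Visual angle\<close>

text \<open>\<open>unit_dir P \<alpha>\<close> is the unit vector at angle \<open>\<alpha>\<close> in the positively oriented orthonormal basis
  consisting of \<open>ref_dir P\<close> and the normalised \<open>P\<close>.\<close>

definition unit_dir :: "real^2 \<Rightarrow> real \<Rightarrow> real^2"
  where "unit_dir P \<alpha> = cos \<alpha> *\<^sub>R ref_dir P + sin \<alpha> *\<^sub>R ((1 / norm P) *\<^sub>R P)"

text \<open>The visual angle of \<open>K\<close> from \<open>P\<close> is the angle of the cone formed by the half-lines from \<open>P\<close>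
  that meet \<open>K\<close>. This cone contains the half-line towards the origin, which splits it, and it is
  bounded by the half-lines of directions \<open>- unit_dir P \<alpha>\<close> and \<open>- unit_dir P \<beta>\<close> that touch \<open>K\<close>.
  Directions of unoriented lines in \<open>(0, pi)\<close> do not always determine this: when a tangent
  half-line makes an angle of at least \<open>pi / 2\<close> with the half-line towards the origin (this happens
  near the boundary of any \<open>K\<close> other than a disc centred at the origin), the two support lines do
  not have directions in \<open>(0, pi)\<close> on different sides of \<open>pi / 2\<close>. Therefore the half-line
  that touches \<open>K\<close> is recorded, and the angles \<open>\<alpha>\<close>, \<open>\<beta>\<close> range over \<open>(- pi / 2, pi / 2)\<close>
  and \<open>(pi / 2, 3 * pi / 2)\<close>. Lemma \<open>support_angles_eq_directions\<close> below shows that \<open>\<alpha>\<close>, \<open>\<beta>\<close> are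
  the directions of the support lines as soon as these lie on different sides of \<open>pi / 2\<close>.\<close>

definition support_angle :: "(real^2) set \<Rightarrow> real^2 \<Rightarrow> real \<Rightarrow> bool"
  where "support_angle K P \<alpha> \<longleftrightarrow>
    support_line K (line_through P (unit_dir P \<alpha>)) \<and> (\<exists>t>0. P - t *\<^sub>R unit_dir P \<alpha> \<in> K)"

definition angle_alpha :: "(real^2) set \<Rightarrow> real^2 \<Rightarrow> real"
  where "angle_alpha K P = (THE \<alpha>. - pi / 2 < \<alpha> \<and> \<alpha> < pi / 2 \<and> support_angle K P \<alpha>)"

definition angle_beta :: "(real^2) set \<Rightarrow> real^2 \<Rightarrow> real"
  where "angle_beta K P = (THE \<beta>. pi / 2 < \<beta> \<and> \<beta> < 3 * pi / 2 \<and> support_angle K P \<beta>)"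

definition visual_angle :: "(real^2) set \<Rightarrow> real^2 \<Rightarrow> real"
  where "visual_angle K P = angle_beta K P - angle_alpha K P"

definition visual_angle1 :: "(real^2) set \<Rightarrow> real^2 \<Rightarrow> real"
  where "visual_angle1 K P = pi / 2 - angle_alpha K P"

definition visual_angle2 :: "(real^2) set \<Rightarrow> real^2 \<Rightarrow> real"
  where "visual_angle2 K P = angle_beta K P - pi / 2"

subsection \<open>The angles agree with the directions of the support lines\<close>

lemma visual_angle_split: "visual_angle K P = visual_angle1 K P + visual_angle2 K P"
  by (simp add: visual_angle_def visual_angle1_def visual_angle2_def)

definition det2 :: "real^2 \<Rightarrow> real^2 \<Rightarrow> real"
  where "det2 u v = u $ 1 * v $ 2 - u $ 2 * v $ 1"

lemma det2_linear:
  "det2 u (a *\<^sub>R v) = a * det2 u v" "det2 u (- v) = - det2 u v" "det2 u (v + w) = det2 u v + det2 u w"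
  by (simp_all add: det2_def algebra_simps)

lemma ref_dir_nth:
  "ref_dir P $ 1 = P $ 2 / norm P" "ref_dir P $ 2 = - P $ 1 / norm P"
  by (simp_all add: ref_dir_def)

lemma unit_dir_nth:
  "unit_dir P a $ 1 = (cos a * P $ 2 + sin a * P $ 1) / norm P"
  "unit_dir P a $ 2 = (sin a * P $ 2 - cos a * P $ 1) / norm P"
  by (simp_all add: unit_dir_def ref_dir_nth add_divide_distrib diff_divide_distrib)

lemma det2_unit_dir:
  assumes "P \<noteq> 0"
  shows "det2 (unit_dir P a) (unit_dir P b) = sin (b - a)"
    and "det2 (unit_dir P a) P = norm P * cos a"
proof -
  define c where "c = P $ 1 / norm P"
  define d where "d = P $ 2 / norm P"
  have 1: "c * c + d * d = 1" using normalised_nth[OF assms] by (simp add: c_def d_def)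
  have P: "P $ 1 = norm P * c" "P $ 2 = norm P * d" using assms by (simp_all add: c_def d_def)
  have U: "unit_dir P a $ 1 = cos a * d + sin a * c" "unit_dir P a $ 2 = sin a * d - cos a * c" for a
    unfolding unit_dir_nth c_def d_def by (simp_all add: add_divide_distrib diff_divide_distrib)
  show "det2 (unit_dir P a) (unit_dir P b) = sin (b - a)"
    unfolding det2_def U sin_diff using 1 by algebra
  show "det2 (unit_dir P a) P = norm P * cos a"
    unfolding det2_def U P using 1 by algebra
qed

lemma has_directionD:
  assumes "P \<noteq> 0" "has_direction P G a"
  shows "0 < a" "a < pi" "G = line_through P (unit_dir P a)"
proof -
  obtain v where v: "norm v = 1" "G = line_through P v" "pos_oriented (ref_dir P) v"
    "cos a = ref_dir P \<bullet> v" and a: "0 < a" "a < pi"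
    using assms(2) by (auto simp: has_direction_def)
  define u where "u = ref_dir P"
  have u: "norm u = 1" using ref_dir_iff[OF assms(1), of u] by (simp add: u_def)
  have U: "u $ 1 * u $ 1 + u $ 2 * u $ 2 = 1" and V: "v $ 1 * v $ 1 + v $ 2 * v $ 2 = 1"
    using norm_sq_2[of u] norm_sq_2[of v] u v(1) by (simp_all add: power2_eq_square)
  define s where "s = u $ 1 * v $ 2 - u $ 2 * v $ 1"
  have s: "s > 0" using v(3) by (simp add: s_def u_def pos_oriented_iff)
  have c: "cos a = u $ 1 * v $ 1 + u $ 2 * v $ 2" using v(4) by (simp add: u_def inner_2')
  have "s\<^sup>2 + (cos a)\<^sup>2 =
      (u $ 1 * u $ 1 + u $ 2 * u $ 2) * (v $ 1 * v $ 1 + v $ 2 * v $ 2)"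
    unfolding s_def c by algebra
  then have "s\<^sup>2 = (sin a)\<^sup>2" using sin_cos_squared_add[of a] unfolding U V by linarith
  then have sa: "s = sin a" using s sin_gt_zero[OF a] by (simp add: power2_eq_iff_nonneg)
  have P: "P $ 1 / norm P = - u $ 2" "P $ 2 / norm P = u $ 1"
    by (simp_all add: u_def ref_dir_nth)
  have "unit_dir P a $ 1 = cos a * u $ 1 - s * u $ 2" "unit_dir P a $ 2 = s * u $ 1 + cos a * u $ 2"
    using arg_cong[OF P(1), of "\<lambda>x. sin a * x"] arg_cong[OF P(2), of "\<lambda>x. sin a * x"]
    by (simp_all add: unit_dir_def u_def[symmetric] sa)
  moreover have "cos a * u $ 1 - s * u $ 2 = v $ 1" "s * u $ 1 + cos a * u $ 2 = v $ 2"
    unfolding c s_def using U by algebra+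
  ultimately have "unit_dir P a = v" by (simp add: vec_eq_iff forall_2)
  then show "0 < a" "a < pi" "G = line_through P (unit_dir P a)" using a v(2) by auto
qed

lemma support_line_same_side:
  assumes "support_line K (line_through P v)" "x \<in> K" "y \<in> K"
  shows "det2 v (x - P) * det2 v (y - P) \<ge> 0"
proof -
  obtain n c where n: "n \<noteq> 0" "line_through P v = {x. n \<bullet> x = c}" "K \<subseteq> {x. n \<bullet> x \<le> c}"
    using assms(1) by (auto simp: support_line_def)
  have "P + 0 *\<^sub>R v \<in> line_through P v" "P + 1 *\<^sub>R v \<in> line_through P v"
    unfolding line_through_def by blast+
  then have P: "n \<bullet> P = c" and "n \<bullet> v = 0" using n(2) by (auto simp: inner_add_right)
  then have nv: "n $ 1 * v $ 1 + n $ 2 * v $ 2 = 0" by (simp add: inner_2')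
  have m: "n \<bullet> (x - P) \<le> 0" "n \<bullet> (y - P) \<le> 0" using n(3) assms P by (auto simp: inner_diff_right)
  have N: "n $ 1 * n $ 1 + n $ 2 * n $ 2 > 0"
    using n(1) norm_sq_2[of n] by (metis power2_eq_square zero_less_norm_iff zero_less_power)
  define k where "k = n $ 2 * v $ 1 - n $ 1 * v $ 2"
  have *: "(n $ 1 * n $ 1 + n $ 2 * n $ 2) * det2 v w = k * (n \<bullet> w)" for w
    unfolding k_def det2_def inner_2' using nv by algebra
  have "(n $ 1 * n $ 1 + n $ 2 * n $ 2)\<^sup>2 * (det2 v (x - P) * det2 v (y - P))
      = ((n $ 1 * n $ 1 + n $ 2 * n $ 2) * det2 v (x - P)) * ((n $ 1 * n $ 1 + n $ 2 * n $ 2) * det2 v (y - P))"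
    by (simp add: power2_eq_square)
  also have "\<dots> = k\<^sup>2 * ((n \<bullet> (x - P)) * (n \<bullet> (y - P)))"
    unfolding * by (simp add: power2_eq_square)
  also have "\<dots> \<ge> 0" using m by (simp add: mult_nonpos_nonpos)
  finally have "0 \<le> (n $ 1 * n $ 1 + n $ 2 * n $ 2)\<^sup>2 * (det2 v (x - P) * det2 v (y - P))" .
  then show ?thesis using N zero_less_power[OF N, of 2] by (metis mult_pos_neg not_le)
qed

lemma support_angle_unique:
  assumes "0 \<in> K" "P \<noteq> 0" "support_angle K P a" "support_angle K P b"
    and "a < b" "b - a < pi" "cos a * cos b > 0"
  shows False
proof -
  obtain t where t: "t > 0" "P - t *\<^sub>R unit_dir P a \<in> K" using assms(3) by (auto simp: support_angle_def)
  obtain r where r: "r > 0" "P - r *\<^sub>R unit_dir P b \<in> K" using assms(4) by (auto simp: support_angle_def)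
  have N: "norm P > 0" using assms(2) by simp
  have s: "sin (b - a) > 0" using assms by (intro sin_gt_zero) auto
  have "det2 (unit_dir P a) (0 - P) * det2 (unit_dir P a) ((P - r *\<^sub>R unit_dir P b) - P) \<ge> 0"
    using assms(3) r assms(1) by (intro support_line_same_side) (auto simp: support_angle_def)
  then have "(norm P * (r * sin (b - a))) * cos a \<ge> 0"
    using det2_unit_dir[OF assms(2)] det2_linear(1)[of _ "-r"] by (simp add: det2_linear algebra_simps)
  moreover have "norm P * (r * sin (b - a)) > 0" using N r s by simp
  ultimately have A: "cos a \<ge> 0" by (metis mult_pos_neg not_le)
  have "det2 (unit_dir P b) (0 - P) * det2 (unit_dir P b) ((P - t *\<^sub>R unit_dir P a) - P) \<ge> 0"
    using assms(4) t assms(1) by (intro support_line_same_side) (auto simp: support_angle_def)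
  then have "(norm P * (t * sin (a - b))) * cos b \<ge> 0"
    using det2_unit_dir[OF assms(2)] det2_linear(1)[of _ "-t"] by (simp add: det2_linear algebra_simps)
  moreover have "sin (a - b) < 0" using s sin_minus[of "b - a"] by simp
  then have "norm P * (t * sin (a - b)) < 0" using N t by (simp add: mult_pos_neg)
  ultimately have "cos b \<le> 0" by (metis mult_neg_pos not_le)
  with A assms(7) show False by (smt (verit) mult_nonneg_nonpos)
qed

lemma cos_neg_upper: "pi / 2 < b \<Longrightarrow> b < 3 * pi / 2 \<Longrightarrow> cos b < 0"
  using cos_gt_zero_pi[of "b - pi"] by (simp add: cos_diff)

lemma angle_alpha_eq:
  assumes "0 \<in> K" "P \<noteq> 0" "- pi / 2 < a" "a < pi / 2" "support_angle K P a"
  shows "angle_alpha K P = a"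
  unfolding angle_alpha_def
proof (rule the_equality)
  fix b assume b: "- pi / 2 < b \<and> b < pi / 2 \<and> support_angle K P b"
  then have "cos a * cos b > 0" using assms by (intro mult_pos_pos cos_gt_zero_pi) auto
  then show "b = a"
    using support_angle_unique[of K P a b] support_angle_unique[of K P b a] assms b
    by (cases a b rule: linorder_cases) (auto simp: mult.commute)
qed (use assms in auto)

lemma angle_beta_eq:
  assumes "0 \<in> K" "P \<noteq> 0" "pi / 2 < a" "a < 3 * pi / 2" "support_angle K P a"
  shows "angle_beta K P = a"
  unfolding angle_beta_def
proof (rule the_equality)
  fix b assume b: "pi / 2 < b \<and> b < 3 * pi / 2 \<and> support_angle K P b"
  then have "cos a * cos b > 0" using assms by (intro mult_neg_neg cos_neg_upper) auto
  then show "b = a"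
    using support_angle_unique[of K P a b] support_angle_unique[of K P b a] assms b
    by (cases a b rule: linorder_cases) (auto simp: mult.commute)
qed (use assms in auto)

lemma support_angles_eq_directions:
  assumes "0 \<in> K" "P \<notin> K"
    and G: "support_line K G" "has_direction P G a" "a < pi / 2"
    and G': "support_line K G'" "has_direction P G' b" "pi / 2 < b"
  shows "angle_alpha K P = a" "angle_beta K P = b"
proof -
  have P: "P \<noteq> 0" using assms by auto
  have N: "norm P > 0" using P by simp
  note A = has_directionD[OF P G(2)] and B = has_directionD[OF P G'(2)]
  have ca: "cos a > 0" using A G by (intro cos_gt_zero_pi) auto
  have cb: "cos b < 0" using B G' by (intro cos_neg_upper) auto
  have s: "sin (b - a) > 0" using A B G G' by (intro sin_gt_zero) auto
  obtain t where t: "P + t *\<^sub>R unit_dir P a \<in> K" using G(1) A(3) by (auto simp: support_line_def line_through_def)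
  obtain r where r: "P + r *\<^sub>R unit_dir P b \<in> K" using G'(1) B(3) by (auto simp: support_line_def line_through_def)
  have "t \<noteq> 0" "r \<noteq> 0" using t r assms(2) by auto
  have "det2 (unit_dir P b) (0 - P) * det2 (unit_dir P b) ((P + t *\<^sub>R unit_dir P a) - P) \<ge> 0"
    using G'(1) B(3) t assms(1) by (intro support_line_same_side) auto
  then have "t * (norm P * (cos b * sin (b - a))) \<ge> 0"
    using det2_unit_dir[OF P] sin_minus[of "b - a"] by (simp add: det2_linear algebra_simps)
  moreover have "norm P * (cos b * sin (b - a)) < 0" using N s cb by (simp add: mult_pos_neg mult_neg_pos)
  ultimately have "t < 0" using \<open>t \<noteq> 0\<close> by (metis mult_pos_neg not_le linorder_neqE_linordered_idom)
  have "det2 (unit_dir P a) (0 - P) * det2 (unit_dir P a) ((P + r *\<^sub>R unit_dir P b) - P) \<ge> 0"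
    using G(1) A(3) r assms(1) by (intro support_line_same_side) auto
  then have "- r * (norm P * (cos a * sin (b - a))) \<ge> 0"
    using det2_unit_dir[OF P] by (simp add: det2_linear algebra_simps)
  moreover have "norm P * (cos a * sin (b - a)) > 0" using N s ca by simp
  ultimately have "- r \<ge> 0" by (metis mult_neg_pos not_le)
  then have "r < 0" using \<open>r \<noteq> 0\<close> by simp
  have "P - (- t) *\<^sub>R unit_dir P a \<in> K" "P - (- r) *\<^sub>R unit_dir P b \<in> K"
    using t r by simp_all
  then have "support_angle K P a" "support_angle K P b"
    using G(1) A(3) G'(1) B(3) \<open>t < 0\<close> \<open>r < 0\<close> unfolding support_angle_def
    by (metis neg_0_less_iff_less)+
  then show "angle_alpha K P = a" "angle_beta K P = b"
    using assms A B P by (auto intro!: angle_alpha_eq angle_beta_eq)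
qed

end

theory Submission
  imports Defs
begin

text \<open>
  Write \<open>k u = f u * \<bar>sin u\<bar>\<close>. A pair of non-parallel lines is the same thing as its intersection
  point \<open>P\<close> together with the two normal angles, and in these coordinates the measure on pairs of
  lines is \<open>\<bar>sin (\<phi>2 - \<phi>1)\<bar> dP d\<phi>1 d\<phi>2\<close> (\<open>lborel_line_pairs\<close>). By Fubini the left-hand side becomes
  the integral over all points \<open>P\<close> of
  \<open>\<Phi> P = \<integral>\<integral> k (\<phi>2 - \<phi>1) d\<phi>1 d\<phi>2\<close>, where both angles run over the set \<open>A P\<close> of the normal angles of
  those lines through \<open>P\<close> that meet \<open>K\<close>. The theorem is the evaluation of \<open>\<Phi>\<close> at each point.

  Because \<open>f\<close> is even, \<open>k u = H'' \<bar>u\<bar>\<close> for \<open>\<bar>u\<bar> \<le> pi\<close>, so that \<open>H \<bar>u\<bar>\<close> is a second antiderivative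
  of \<open>k\<close> there and the integral of \<open>k (y - x)\<close> over a rectangle is a combination of four values of
  \<open>H\<close> (\<open>has_integral_box\<close>). Measure angles from the direction of \<open>ref_dir P\<close>; this is harmless as
  everything is \<open>2 * pi\<close>-periodic. A line through \<open>P\<close> is represented by the normal that points to
  the side of \<open>P\<close>, thus by an angle in \<open>(0, pi)\<close>. If \<open>P \<in> K\<close>, the set \<open>A P\<close> is all of \<open>(0, pi)\<close> and
  \<open>\<Phi> P = 2 * H pi\<close>. If \<open>P \<notin> K\<close>, the missing angles are the normals of the lines that separate \<open>P\<close>
  strictly from \<open>K\<close>; they form an open interval \<open>(m, M)\<close>, whose ends belong to the two support lines
  through \<open>P\<close>, so that \<open>m = \<omega>2\<close> and \<open>pi - M = \<omega>1\<close> (\<open>missing_directions_interval\<close>). Hence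
  \<open>A P = (0, \<omega>2] \<union> [pi - \<omega>1, pi)\<close>. The two arcs contribute \<open>2 * H \<omega>2\<close> and \<open>2 * H \<omega>1\<close>, and their
  interaction contributes \<open>2 * (H \<omega>1 + H \<omega>2 - H \<omega>)\<close>. The last value uses the only
  consequence of anti-periodicity apart from periodicity, the symmetry \<open>H (pi - u) = H pi - H u\<close>
  (\<open>H_reflect\<close>). The same symmetry gives \<open>H pi = 2 * H (pi / 2)\<close>, which turns the value \<open>2 * H pi\<close> on
  \<open>K\<close> into the stated coefficient \<open>2 * (4 * H (pi / 2) - H pi)\<close>.
\<close>

section \<open>Linear changes of variables in the plane\<close>

text \<open>\<open>height P \<phi>\<close> is the signed distance from the origin of the line through \<open>P\<close> with normal angle
  \<open>\<phi>\<close>, so that \<open>(height P \<phi>, \<phi>)\<close> are the coordinates of this line when it is positive. As a function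
  of \<open>P\<close> it is the inner product with the unit normal.\<close>

definition height :: "real^2 \<Rightarrow> real \<Rightarrow> real"
  where "height P \<phi> = P $ 1 * cos \<phi> + P $ 2 * sin \<phi>"

lemma continuous_height [continuous_intros]:
  fixes S :: "'a::t2_space set"
  assumes "continuous_on S u" "continuous_on S v"
  shows "continuous_on S (\<lambda>z. height (u z) (v z))"
  unfolding height_def by (intro continuous_intros assms)

lemma borel_measurable_nth [measurable]: "(\<lambda>P::real^2. P $ i) \<in> borel_measurable borel"
  by (intro borel_measurable_continuous_onI continuous_intros)

lemma continuous_vector2: "continuous_on UNIV (\<lambda>(x, y). vector [x, y] :: real^2)"
proof -
  have "(\<lambda>(x, y). vector [x, y] :: real^2) = (\<lambda>z. fst z *\<^sub>R axis 1 1 + snd z *\<^sub>R axis 2 1)"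
    by (auto simp: fun_eq_iff vec_eq_iff forall_2 axis_def)
  then show ?thesis by (simp only:) (intro continuous_intros)
qed

lemma borel_measurable_vector2 [measurable]: "(\<lambda>(x, y). vector [x, y] :: real^2) \<in> borel_measurable borel"
  by (rule borel_measurable_continuous_onI[OF continuous_vector2])

lemma Basis_real2: "Basis = {axis 1 1, axis 2 1 :: real^2}"
  by (auto simp: Basis_vec_def UNIV_2)

lemma axis_12_neq: "(axis 1 1 :: real^2) \<noteq> axis 2 1"
  by (simp add: axis_eq_axis)

text \<open>This transfers iterated integration from pairs of reals to the vectors that represent points:
  both Lebesgue measures give a box the product of its side lengths.\<close>

lemma lborel_real2_eq_distr: "(lborel :: (real^2) measure) = distr lborel borel (\<lambda>(x, y). vector [x, y])"
proof (rule lborel_eqI)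
  fix l u :: "real^2"
  assume lu: "\<And>b. b \<in> Basis \<Longrightarrow> l \<bullet> b \<le> u \<bullet> b"
  have le: "l $ 1 \<le> u $ 1" "l $ 2 \<le> u $ 2"
    using lu[of "axis 1 1"] lu[of "axis 2 1"] by (auto simp: Basis_real2 inner_axis)
  have pre: "(\<lambda>(x, y). vector [x, y]) -` box l u = {l $ 1 <..< u $ 1} \<times> {l $ 2 <..< u $ 2}"
    by (auto simp: mem_box_cart forall_2)
  have "emeasure (distr lborel borel (\<lambda>(x, y). vector [x, y])) (box l u)
      = emeasure (lborel \<Otimes>\<^sub>M lborel) ({l $ 1 <..< u $ 1} \<times> {l $ 2 <..< u $ 2})"
    by (subst emeasure_distr) (simp_all add: pre lborel_prod)
  also have "\<dots> = (\<Prod>b\<in>Basis. (u - l) \<bullet> b)"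
    using le by (subst lborel.emeasure_pair_measure_Times)
      (simp_all add: Basis_real2 axis_12_neq inner_axis ennreal_mult[symmetric])
  finally show "emeasure (distr lborel borel (\<lambda>(x, y). vector [x, y])) (box l u) = (\<Prod>b\<in>Basis. (u - l) \<bullet> b)" .
qed simp

text \<open>Two lines are given as \<open>((p1, \<phi>1), (p2, \<phi>2))\<close>, whereas the passage to the intersection point
  treats the distances \<open>(p1, p2)\<close> together, for fixed normal angles.\<close>

lemma lborel_pairs_regroup:
  "(lborel :: ((real \<times> real) \<times> (real \<times> real)) measure)
    = distr lborel borel (\<lambda>((a, b), (c, d)). ((a, c), (b, d)))" (is "_ = distr _ _ ?T")
proof (rule lborel_eqI)
  have meas: "?T \<in> borel_measurable borel"
    by (intro borel_measurable_continuous_onI) (simp add: split_beta continuous_intros)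
  fix l u :: "(real \<times> real) \<times> (real \<times> real)"
  assume lu: "\<And>b. b \<in> Basis \<Longrightarrow> l \<bullet> b \<le> u \<bullet> b"
  obtain l1 l2 l3 l4 where l: "l = ((l1, l2), (l3, l4))" by (metis surj_pair)
  obtain u1 u2 u3 u4 where u: "u = ((u1, u2), (u3, u4))" by (metis surj_pair)
  have le: "l1 \<le> u1" "l2 \<le> u2" "l3 \<le> u3" "l4 \<le> u4"
    using lu[of "((1, 0), (0, 0))"] lu[of "((0, 1), (0, 0))"] lu[of "((0, 0), (1, 0))"]
      lu[of "((0, 0), (0, 1))"] by (auto simp: l u Basis_prod_def zero_prod_def)
  have pre: "?T -` box l u = ({l1 <..< u1} \<times> {l3 <..< u3}) \<times> ({l2 <..< u2} \<times> {l4 <..< u4})"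
    by (auto simp: l u box_def Basis_prod_def)
  have "emeasure (distr lborel borel ?T) (box l u)
      = emeasure (lborel \<Otimes>\<^sub>M lborel) (({l1 <..< u1} \<times> {l3 <..< u3}) \<times> ({l2 <..< u2} \<times> {l4 <..< u4}))"
    using meas by (subst emeasure_distr) (simp_all add: pre lborel_prod)
  also have "\<dots> = emeasure (lborel \<Otimes>\<^sub>M lborel) ({l1 <..< u1} \<times> {l3 <..< u3})
      * emeasure (lborel \<Otimes>\<^sub>M lborel) ({l2 <..< u2} \<times> {l4 <..< u4})"
    by (subst lborel.emeasure_pair_measure_Times) (simp_all add: lborel_prod borel_open open_Times)
  also have "\<dots> = (\<Prod>b\<in>Basis. (u - l) \<bullet> b)"
  proof -
    have B: "(Basis :: ((real \<times> real) \<times> (real \<times> real)) set)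
        = {((1, 0), (0, 0)), ((0, 1), (0, 0)), ((0, 0), (1, 0)), ((0, 0), (0, 1))}"
      by (auto simp: Basis_prod_def zero_prod_def)
    show ?thesis
      using le by (simp add: lborel.emeasure_pair_measure_Times B l u ennreal_mult[symmetric] mult_ac)
  qed
  finally show "emeasure (distr lborel borel ?T) (box l u) = (\<Prod>b\<in>Basis. (u - l) \<bullet> b)" .
qed simp

lemma nn_integral_real_linear:
  fixes k :: "real \<Rightarrow> ennreal"
  assumes [measurable]: "k \<in> borel_measurable borel" and "c \<noteq> 0"
  shows "(\<integral>\<^sup>+x. k (c * x + t) \<partial>lborel) = ennreal (1 / \<bar>c\<bar>) * (\<integral>\<^sup>+x. k x \<partial>lborel)"
proof -
  have "(\<integral>\<^sup>+x. k x \<partial>lborel) = ennreal \<bar>c\<bar> * (\<integral>\<^sup>+x. k (t + c * x) \<partial>lborel)"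
    by (rule nn_integral_real_affine) (use assms in auto)
  moreover have "ennreal (1 / \<bar>c\<bar>) * ennreal \<bar>c\<bar> = 1"
    using assms by (simp add: ennreal_mult[symmetric])
  ultimately show ?thesis
    by (simp add: mult.assoc[symmetric] add.commute)
qed

text \<open>Gaussian elimination with pivot \<open>a\<close>: substituting \<open>p = a * x + b * y\<close> for \<open>x\<close> contributes the
  factor \<open>1 / \<bar>a\<bar>\<close>, and the second coordinate becomes \<open>c / a * p + D / a * y\<close> with the determinant \<open>D\<close>,
  so that the substitution for \<open>y\<close> contributes \<open>\<bar>a\<bar> / \<bar>D\<bar>\<close>.\<close>

lemma nn_integral_linear2_iterated:
  fixes G :: "real \<times> real \<Rightarrow> ennreal"
  assumes [measurable]: "G \<in> borel_measurable borel" and "a \<noteq> 0" and D: "a * d - b * c \<noteq> 0"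
  shows "(\<integral>\<^sup>+y. \<integral>\<^sup>+x. G (a * x + b * y, c * x + d * y) \<partial>lborel \<partial>lborel)
      = ennreal (1 / \<bar>a * d - b * c\<bar>) * (\<integral>\<^sup>+z. G z \<partial>lborel)"
proof -
  have G[measurable]: "G \<in> borel_measurable (borel \<Otimes>\<^sub>M borel)" by (simp add: borel_prod)
  define D where "D = a * d - b * c"
  have "(\<integral>\<^sup>+y. \<integral>\<^sup>+x. G (a * x + b * y, c * x + d * y) \<partial>lborel \<partial>lborel)
      = (\<integral>\<^sup>+y. ennreal (1 / \<bar>a\<bar>) * (\<integral>\<^sup>+p. G (p, c / a * p + D / a * y) \<partial>lborel) \<partial>lborel)"
  proof (intro nn_integral_cong)
    fix y
    have "(\<integral>\<^sup>+x. G (a * x + b * y, c * x + d * y) \<partial>lborel)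
        = (\<integral>\<^sup>+x. G (a * x + b * y, c / a * (a * x + b * y) + D / a * y) \<partial>lborel)"
    proof (intro nn_integral_cong arg_cong[of _ _ G])
      fix x
      have "c * x + d * y = c / a * (a * x + b * y) + D / a * y"
        using \<open>a \<noteq> 0\<close> by (simp add: D_def field_simps)
      then show "(a * x + b * y, c * x + d * y) = (a * x + b * y, c / a * (a * x + b * y) + D / a * y)"
        by simp
    qed
    also have "\<dots> = ennreal (1 / \<bar>a\<bar>) * (\<integral>\<^sup>+p. G (p, c / a * p + D / a * y) \<partial>lborel)"
      by (rule nn_integral_real_linear[OF _ \<open>a \<noteq> 0\<close>]) measurable
    finally show "(\<integral>\<^sup>+x. G (a * x + b * y, c * x + d * y) \<partial>lborel)
        = ennreal (1 / \<bar>a\<bar>) * (\<integral>\<^sup>+p. G (p, c / a * p + D / a * y) \<partial>lborel)" .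
  qed
  also have "\<dots> = ennreal (1 / \<bar>a\<bar>) * (\<integral>\<^sup>+y. \<integral>\<^sup>+p. G (p, c / a * p + D / a * y) \<partial>lborel \<partial>lborel)"
    by (rule nn_integral_cmult) measurable
  also have "(\<integral>\<^sup>+y. \<integral>\<^sup>+p. G (p, c / a * p + D / a * y) \<partial>lborel \<partial>lborel)
      = (\<integral>\<^sup>+p. \<integral>\<^sup>+y. G (p, D / a * y + c / a * p) \<partial>lborel \<partial>lborel)"
    by (subst lborel_pair.Fubini') (simp_all add: add.commute)
  also have "\<dots> = (\<integral>\<^sup>+p. ennreal (1 / \<bar>D / a\<bar>) * (\<integral>\<^sup>+q. G (p, q) \<partial>lborel) \<partial>lborel)"
    using \<open>a \<noteq> 0\<close> D by (intro nn_integral_cong nn_integral_real_linear) (simp_all add: D_def)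
  also have "\<dots> = ennreal (1 / \<bar>D / a\<bar>) * (\<integral>\<^sup>+p. \<integral>\<^sup>+q. G (p, q) \<partial>lborel \<partial>lborel)"
    by (rule nn_integral_cmult) measurable
  also have "(\<integral>\<^sup>+p. \<integral>\<^sup>+q. G (p, q) \<partial>lborel \<partial>lborel) = (\<integral>\<^sup>+z. G z \<partial>lborel)"
    by (subst lborel.nn_integral_fst) (simp_all add: lborel_prod)
  also have "ennreal (1 / \<bar>a\<bar>) * (ennreal (1 / \<bar>D / a\<bar>) * (\<integral>\<^sup>+z. G z \<partial>lborel))
      = ennreal (1 / \<bar>D\<bar>) * (\<integral>\<^sup>+z. G z \<partial>lborel)"
    using \<open>a \<noteq> 0\<close> by (simp add: mult.assoc[symmetric] ennreal_mult[symmetric] abs_divide)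
  finally show ?thesis by (simp add: D_def)
qed

lemma nn_integral_linear2:
  fixes G :: "real \<times> real \<Rightarrow> ennreal"
  assumes G[measurable]: "G \<in> borel_measurable borel" and D: "a * d - b * c \<noteq> 0"
  shows "ennreal \<bar>a * d - b * c\<bar> * (\<integral>\<^sup>+(P::real^2). G (a * P $ 1 + b * P $ 2, c * P $ 1 + d * P $ 2) \<partial>lborel)
      = (\<integral>\<^sup>+z. G z \<partial>lborel)"
proof -
  have G'[measurable]: "G \<in> borel_measurable (borel \<Otimes>\<^sub>M borel)" by (simp add: borel_prod)
  have [measurable]: "(\<lambda>P::real^2. G (a * P $ 1 + b * P $ 2, c * P $ 1 + d * P $ 2)) \<in> borel_measurable borel"
    by measurable
  have 1: "(\<integral>\<^sup>+(P::real^2). G (a * P $ 1 + b * P $ 2, c * P $ 1 + d * P $ 2) \<partial>lborel)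
      = (\<integral>\<^sup>+x. \<integral>\<^sup>+y. G (a * x + b * y, c * x + d * y) \<partial>lborel \<partial>lborel)"
  proof -
    have "(\<integral>\<^sup>+(P::real^2). G (a * P $ 1 + b * P $ 2, c * P $ 1 + d * P $ 2) \<partial>lborel)
        = (\<integral>\<^sup>+z. (\<lambda>(x, y). G (a * x + b * y, c * x + d * y)) z \<partial>lborel)"
      using borel_measurable_vector2
      by (subst lborel_real2_eq_distr, subst nn_integral_distr) (simp_all add: case_prod_unfold)
    also have "\<dots> = (\<integral>\<^sup>+x. \<integral>\<^sup>+y. G (a * x + b * y, c * x + d * y) \<partial>lborel \<partial>lborel)"
      by (subst lborel_prod[symmetric], subst lborel.nn_integral_fst[symmetric]) simp_all
    finally show ?thesis .
  qed
  have 2: "\<dots> = ennreal (1 / \<bar>a * d - b * c\<bar>) * (\<integral>\<^sup>+z. G z \<partial>lborel)"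
  proof (cases "a = 0")
    case False
    have "(\<integral>\<^sup>+x. \<integral>\<^sup>+y. G (a * x + b * y, c * x + d * y) \<partial>lborel \<partial>lborel)
        = (\<integral>\<^sup>+y. \<integral>\<^sup>+x. G (a * x + b * y, c * x + d * y) \<partial>lborel \<partial>lborel)"
      by (subst lborel_pair.Fubini') simp_all
    then show ?thesis using nn_integral_linear2_iterated[OF G False D] by simp
  next
    case True
    \<comment> \<open>Here \<open>b\<close> serves as the pivot; this amounts to exchanging the roles of \<open>x\<close> and \<open>y\<close>.\<close>
    then have "b \<noteq> 0" "b * c - a * d \<noteq> 0" using D by auto
    from nn_integral_linear2_iterated[OF G this] show ?thesis
      by (simp add: add.commute abs_minus_commute)
  qed
  show ?thesis
    unfolding 1 2 using D by (simp add: mult.assoc[symmetric] ennreal_mult[symmetric])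
qed

section \<open>Pairs of lines in terms of their intersection point\<close>

text \<open>For each angle of the first normal only countably many angles make the lines parallel.\<close>

lemma AE_not_parallel: "AE z in (lborel :: (real \<times> real) measure). sin (snd z - fst z) \<noteq> 0"
proof -
  have "AE z in lborel \<Otimes>\<^sub>M lborel. sin (snd z - fst z) \<noteq> (0::real)"
  proof (rule lborel_pair.AE_pair_measure)
    show "{z \<in> space (lborel \<Otimes>\<^sub>M lborel). sin (snd z - fst z) \<noteq> (0::real)} \<in> sets (lborel \<Otimes>\<^sub>M lborel)"
      by measurable
    show "AE x in lborel. AE y in lborel. sin (snd (x, y) - fst (x, y)) \<noteq> (0::real)"
    proof (rule AE_I2)
      fix x :: real
      have "{y. sin (y - x) = 0} \<subseteq> range (\<lambda>i::int. x + of_int i * pi)"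
        by (auto simp: sin_zero_iff_int2 image_iff algebra_simps)
      then have "countable {y. sin (y - x) = 0}"
        by (rule countable_subset) simp
      then have "{y. sin (y - x) = 0} \<in> null_sets lborel"
        by (rule countable_imp_null_set_lborel)
      then have "AE y in lborel. y \<notin> {y. sin (y - x) = 0}"
        by (rule AE_not_in)
      then show "AE y in lborel. sin (snd (x, y) - fst (x, y)) \<noteq> (0::real)" by simp
    qed
  qed
  then show ?thesis unfolding lborel_prod .
qed

lemma borel_measurable_abs_sin_diff [measurable]:
  "(\<lambda>w::(real^2) \<times> real \<times> real. \<bar>sin (snd (snd w) - fst (snd w))\<bar>) \<in> borel_measurable borel"
proof -
  have "continuous_on UNIV (\<lambda>w::(real^2) \<times> real \<times> real. \<bar>sin (snd (snd w) - fst (snd w))\<bar>)"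
    by (intro continuous_intros)
  then show ?thesis by (rule borel_measurable_continuous_onI)
qed

text \<open>The inverse of the passage from a pair of lines to their intersection point and normal angles.\<close>

definition lines_through :: "(real^2) \<times> real \<times> real \<Rightarrow> (real \<times> real) \<times> (real \<times> real)"
  where "lines_through = (\<lambda>(P, \<phi>1, \<phi>2). ((height P \<phi>1, \<phi>1), (height P \<phi>2, \<phi>2)))"

lemma borel_measurable_lines_through [measurable]: "lines_through \<in> borel_measurable borel"
  unfolding lines_through_def split_beta
  by (intro borel_measurable_continuous_onI continuous_intros)

text \<open>For fixed normal angles \<open>a\<close> and \<open>b\<close> the distances \<open>(p1, p2)\<close> depend linearly on the intersection
  point, with determinant \<open>cos a * sin b - sin a * cos b = sin (b - a)\<close>.\<close>

lemma nn_integral_line_pairs: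
  fixes F :: "(real \<times> real) \<times> (real \<times> real) \<Rightarrow> ennreal"
  assumes [measurable]: "F \<in> borel_measurable borel"
  shows "(\<integral>\<^sup>+z. F z \<partial>lborel)
    = (\<integral>\<^sup>+w. ennreal \<bar>sin (snd (snd w) - fst (snd w))\<bar> * F (lines_through w) \<partial>lborel)"
proof -
  define R :: "(real \<times> real) \<times> (real \<times> real) \<Rightarrow> (real \<times> real) \<times> (real \<times> real)"
    where "R = (\<lambda>((a, b), (c, d)). ((a, c), (b, d)))"
  have R[measurable]: "R \<in> borel_measurable borel"
    unfolding R_def split_beta by (intro borel_measurable_continuous_onI continuous_intros)
  have FR[measurable]: "(\<lambda>z. F (R z)) \<in> borel_measurable (borel \<Otimes>\<^sub>M borel)"
    unfolding borel_prod by measurable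
  have meas[measurable]: "(\<lambda>w. ennreal \<bar>sin (snd (snd w) - fst (snd w))\<bar> * F (lines_through w))
      \<in> borel_measurable ((borel :: (real^2) measure) \<Otimes>\<^sub>M (borel :: (real \<times> real) measure))"
    unfolding borel_prod
    by (intro borel_measurable_times_ennreal measurable_compose[OF borel_measurable_abs_sin_diff measurable_ennreal]
        measurable_compose[OF borel_measurable_lines_through assms])
  have "(\<integral>\<^sup>+z. F z \<partial>lborel) = (\<integral>\<^sup>+z. F (R z) \<partial>(lborel \<Otimes>\<^sub>M lborel))"
    by (subst lborel_pairs_regroup, subst R_def[symmetric], subst nn_integral_distr)
      (simp_all add: lborel_prod)
  also have "\<dots> = (\<integral>\<^sup>+\<phi>. \<integral>\<^sup>+p. F (R (p, \<phi>)) \<partial>lborel \<partial>lborel)"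
    by (subst lborel_pair.nn_integral_snd[symmetric]) simp_all
  also have "\<dots> = (\<integral>\<^sup>+\<phi>. \<integral>\<^sup>+P. ennreal \<bar>sin (snd \<phi> - fst \<phi>)\<bar> * F (lines_through (P, \<phi>)) \<partial>lborel \<partial>lborel)"
  proof (rule nn_integral_cong_AE)
    show "AE \<phi> in lborel. (\<integral>\<^sup>+p. F (R (p, \<phi>)) \<partial>lborel)
        = (\<integral>\<^sup>+P. ennreal \<bar>sin (snd \<phi> - fst \<phi>)\<bar> * F (lines_through (P, \<phi>)) \<partial>lborel)"
      using AE_not_parallel
    proof eventually_elim
      case (elim \<phi>)
      obtain a b where \<phi>: "\<phi> = (a, b)" by force
      have D: "cos a * sin b - sin a * cos b = sin (b - a)"
        by (simp add: sin_diff)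
      then have "cos a * sin b - sin a * cos b \<noteq> 0" using elim \<phi> by simp
      from nn_integral_linear2[OF _ this, of "\<lambda>p. F (R (p, \<phi>))"]
      have "(\<integral>\<^sup>+p. F (R (p, \<phi>)) \<partial>lborel) = ennreal \<bar>sin (b - a)\<bar> *
          (\<integral>\<^sup>+(P::real^2). F (R ((cos a * P $ 1 + sin a * P $ 2, cos b * P $ 1 + sin b * P $ 2), \<phi>)) \<partial>lborel)"
        unfolding D by simp
      also have "\<dots> = ennreal \<bar>sin (b - a)\<bar> * (\<integral>\<^sup>+P. F (lines_through (P, \<phi>)) \<partial>lborel)"
        by (simp add: R_def lines_through_def \<phi> height_def mult.commute)
      also have "\<dots> = (\<integral>\<^sup>+P. ennreal \<bar>sin (b - a)\<bar> * F (lines_through (P, \<phi>)) \<partial>lborel)"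
        by (rule nn_integral_cmult[symmetric]) simp
      finally show ?case by (simp add: \<phi>)
    qed
  qed
  also have "\<dots> = (\<integral>\<^sup>+w. ennreal \<bar>sin (snd (snd w) - fst (snd w))\<bar> * F (lines_through w) \<partial>(lborel \<Otimes>\<^sub>M lborel))"
    by (subst lborel_pair.nn_integral_snd[symmetric]) simp_all
  finally show ?thesis by (simp add: lborel_prod)
qed

text \<open>The classical formula \<open>dG1 dG2 = \<bar>sin (\<phi>2 - \<phi>1)\<bar> dP d\<phi>1 d\<phi>2\<close> as an identity of measures. In this
  form it also applies to signed integrands.\<close>

lemma lborel_line_pairs:
  "(lborel :: ((real \<times> real) \<times> (real \<times> real)) measure)
    = distr (density lborel (\<lambda>w. ennreal \<bar>sin (snd (snd w) - fst (snd w))\<bar>)) borel lines_through"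
proof (rule measure_eqI)
  fix A :: "((real \<times> real) \<times> (real \<times> real)) set"
  assume "A \<in> sets lborel"
  then have [measurable]: "A \<in> sets borel" by simp
  have "emeasure lborel A = (\<integral>\<^sup>+z. indicator A z \<partial>lborel)"
    by simp
  also have "\<dots> = (\<integral>\<^sup>+w. ennreal \<bar>sin (snd (snd w) - fst (snd w))\<bar> * indicator A (lines_through w) \<partial>lborel)"
    by (rule nn_integral_line_pairs) simp
  also have "\<dots> = (\<integral>\<^sup>+w. indicator A (lines_through w)
      \<partial>density lborel (\<lambda>w. ennreal \<bar>sin (snd (snd w) - fst (snd w))\<bar>))"
    by (subst nn_integral_density) simp_all
  also have "\<dots> = (\<integral>\<^sup>+z. indicator A z
      \<partial>distr (density lborel (\<lambda>w. ennreal \<bar>sin (snd (snd w) - fst (snd w))\<bar>)) borel lines_through)"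
    by (subst nn_integral_distr) simp_all
  finally show "emeasure lborel A = emeasure
      (distr (density lborel (\<lambda>w. ennreal \<bar>sin (snd (snd w) - fst (snd w))\<bar>)) borel lines_through) A"
    by simp
qed simp

lemma
  fixes F :: "(real \<times> real) \<times> (real \<times> real) \<Rightarrow> real"
  assumes F: "integrable lborel F"
  shows integrable_at_intersection:
      "integrable lborel (\<lambda>P. LBINT \<phi>. \<bar>sin (snd \<phi> - fst \<phi>)\<bar> * F (lines_through (P, \<phi>)))"
    and integral_at_intersection:
      "integral\<^sup>L lborel F = (LBINT P. LBINT \<phi>. \<bar>sin (snd \<phi> - fst \<phi>)\<bar> * F (lines_through (P, \<phi>)))"
proof -
  let ?s = "\<lambda>w::(real^2) \<times> real \<times> real. \<bar>sin (snd (snd w) - fst (snd w))\<bar>"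
  have [measurable]: "F \<in> borel_measurable borel"
    using borel_measurable_integrable[OF F] by simp
  have "integrable (distr (density lborel ?s) borel lines_through) F"
    using F by (simp add: lborel_line_pairs[symmetric])
  then have int: "integrable lborel (\<lambda>w. ?s w * F (lines_through w))"
    by (subst (asm) integrable_distr_eq) (simp_all add: integrable_density)
  have eq: "integral\<^sup>L lborel F = integral\<^sup>L lborel (\<lambda>w. ?s w * F (lines_through w))"
    by (subst lborel_line_pairs, subst integral_distr) (simp_all add: integral_density)
  have int': "integrable (lborel \<Otimes>\<^sub>M lborel) (\<lambda>w. ?s w * F (lines_through w))"
    using int by (simp add: lborel_prod)
  show "integrable lborel (\<lambda>P. LBINT \<phi>. \<bar>sin (snd \<phi> - fst \<phi>)\<bar> * F (lines_through (P, \<phi>)))"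
    using lborel_pair.integrable_fst'[OF int'] by simp
  show "integral\<^sup>L lborel F = (LBINT P. LBINT \<phi>. \<bar>sin (snd \<phi> - fst \<phi>)\<bar> * F (lines_through (P, \<phi>)))"
    unfolding eq using lborel_pair.integral_fst'[OF int'] by (simp add: lborel_prod)
qed

section \<open>The kernel and its second antiderivative\<close>

text \<open>The hypotheses on \<open>f\<close> and \<open>H\<close>, shared by all evaluations of angular integrals.\<close>

locale angle_kernel =
  fixes f H H1 H2 :: "real \<Rightarrow> real"
  assumes f_cont: "continuous_on UNIV f"
    and f_anti: "f (x + pi) = - f x"
    and f_even: "f (- x) = f x"
    and H_C2: "C2_on {0..pi} H H1 H2"
    and H2_eq: "x \<in> {0..pi} \<Longrightarrow> H2 x = f x * sin x"
    and H_0: "H 0 = 0"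
    and H1_0: "H1 0 = 0"
begin

text \<open>The integrand \<open>f (\<phi>2 - \<phi>1)\<close> multiplied by the density of the line measure.\<close>

definition kernel :: "real \<Rightarrow> real"
  where "kernel u = \<bar>sin u\<bar> * f u"

lemma kernel_periodic: "kernel (u + 2 * pi) = kernel u" "kernel (u - 2 * pi) = kernel u"
proof -
  have "f (u + 2 * pi) = f u" for u
    using f_anti[of u] f_anti[of "u + pi"] by (simp add: add.assoc)
  then show 1: "kernel (u + 2 * pi) = kernel u" for u
    by (simp add: kernel_def)
  show "kernel (u - 2 * pi) = kernel u"
    using 1[of "u - 2 * pi"] by simp
qed

lemma kernel_minus: "kernel (- u) = kernel u"
  by (simp add: kernel_def f_even)

lemma kernel_cont: "continuous_on S kernel"
  unfolding kernel_def
  by (intro continuous_intros continuous_on_subset[OF f_cont subset_UNIV])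

lemma borel_measurable_kernel [measurable]: "kernel \<in> borel_measurable borel"
  by (rule borel_measurable_continuous_onI[OF kernel_cont])

lemma H_deriv: "t \<in> {0..pi} \<Longrightarrow> (H has_real_derivative H1 t) (at t within {0..pi})"
  and H1_deriv: "t \<in> {0..pi} \<Longrightarrow> (H1 has_real_derivative kernel t) (at t within {0..pi})"
proof -
  assume t: "t \<in> {0..pi}"
  then have "H2 t = kernel t"
    using H2_eq[OF t] sin_ge_zero[of t] by (simp add: kernel_def)
  with t H_C2 show "(H has_real_derivative H1 t) (at t within {0..pi})"
    "(H1 has_real_derivative kernel t) (at t within {0..pi})"
    unfolding C2_on_def has_real_derivative_iff_has_vector_derivative by metis+
qed

lemma H_deriv_reflect:
  "t \<in> {0..pi} \<Longrightarrow> ((\<lambda>t. H (pi - t)) has_real_derivative - H1 (pi - t)) (at t within {0..pi})"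
  "t \<in> {0..pi} \<Longrightarrow> ((\<lambda>t. H1 (pi - t)) has_real_derivative - kernel (pi - t)) (at t within {0..pi})"
proof -
  have im: "(\<lambda>t. pi - t) ` {0..pi} = {0..pi}" by (simp add: image_diff_atLeastAtMost)
  have d: "((\<lambda>t. pi - t) has_real_derivative - 1) (at t within {0..pi})"
    by (auto intro!: derivative_eq_intros)
  assume t: "t \<in> {0..pi}"
  then have t': "pi - t \<in> {0..pi}" by auto
  show "((\<lambda>t. H (pi - t)) has_real_derivative - H1 (pi - t)) (at t within {0..pi})"
    using DERIV_image_chain[of H, OF _ d] H_deriv[OF t'] by (simp add: im o_def)
  show "((\<lambda>t. H1 (pi - t)) has_real_derivative - kernel (pi - t)) (at t within {0..pi})"
    using DERIV_image_chain[of H1, OF _ d] H1_deriv[OF t'] by (simp add: im o_def)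
qed

text \<open>As \<open>f\<close> is even and anti-periodic, the second derivative of \<open>H\<close> is odd about \<open>pi / 2\<close>. Hence
  \<open>H1 t - H1 (pi - t)\<close> is constant, and this constant vanishes at \<open>t = pi / 2\<close>. So the derivative of
  \<open>H t + H (pi - t)\<close> is zero.\<close>

lemma H_reflect:
  assumes "u \<in> {0..pi}"
  shows "H (pi - u) = H pi - H u"
proof -
  have anti: "kernel (pi - t) = - kernel t" for t
    using f_anti[of "- t"] f_even[of t] by (simp add: kernel_def)
  have "\<exists>c. \<forall>t\<in>{0..pi}. H1 t - H1 (pi - t) = c"
  proof (rule has_field_derivative_zero_constant)
    fix t assume t: "t \<in> {0..pi}"
    show "((\<lambda>t. H1 t - H1 (pi - t)) has_real_derivative 0) (at t within {0..pi})"
      using DERIV_diff[OF H1_deriv[OF t] H_deriv_reflect(2)[OF t]] by (simp add: anti)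
  qed simp
  then obtain c where c: "\<And>t. t \<in> {0..pi} \<Longrightarrow> H1 t - H1 (pi - t) = c" by blast
  have "c = 0" using c[of "pi / 2"] by simp
  have "\<exists>c. \<forall>t\<in>{0..pi}. H t + H (pi - t) = c"
  proof (rule has_field_derivative_zero_constant)
    fix t assume t: "t \<in> {0..pi}"
    show "((\<lambda>t. H t + H (pi - t)) has_real_derivative 0) (at t within {0..pi})"
      using DERIV_add[OF H_deriv[OF t] H_deriv_reflect(1)[OF t]] c[OF t] \<open>c = 0\<close> by simp
  qed simp
  then obtain d where d: "\<And>t. t \<in> {0..pi} \<Longrightarrow> H t + H (pi - t) = d" by blast
  show ?thesis using d[OF assms] d[of 0] H_0 by simp
qed

text \<open>The derivative of \<open>H \<bar>u\<bar>\<close>. The odd extension of \<open>H1\<close> is differentiable at \<open>0\<close> because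
  \<open>H1 0 = 0\<close> and the kernel is even.\<close>

definition G1 :: "real \<Rightarrow> real"
  where "G1 u = (if u \<in> {0..pi} then H1 u else - H1 (- u))"

lemma H_abs_eq: "H \<bar>u\<bar> = (if u \<in> {0..pi} then H u else H (- u))" if "u \<in> {- pi..pi}"
  using that by auto

lemma
  assumes "u \<in> {- pi..pi}"
  shows G1_deriv: "(G1 has_real_derivative kernel u) (at u within {- pi..pi})"
    and G_deriv: "((\<lambda>u. H \<bar>u\<bar>) has_real_derivative G1 u) (at u within {- pi..pi})"
proof -
  have im: "uminus ` {- pi..0} = {0..pi}" by simp
  have un: "{- pi..pi} = {0..pi} \<union> {- pi..0}" by auto
  have cl: "closure {0..pi} \<inter> closure {- pi..0} = {0}" by (auto simp: set_eq_iff)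
  have ins: "insert 0 {0..pi} = {0..pi}" "insert 0 {- pi..0} = {- pi..0}" by auto
  have d: "(uminus has_real_derivative - 1) (at t within {- pi..0})" for t :: real
    by (auto intro!: derivative_eq_intros)
  have neg: "((\<lambda>t. H (- t)) has_real_derivative - H1 (- t)) (at t within {- pi..0})"
    "((\<lambda>t. - H1 (- t)) has_real_derivative kernel t) (at t within {- pi..0})"
    if "t \<in> {- pi..0}" for t
  proof -
    have t': "- t \<in> {0..pi}" using that by auto
    show "((\<lambda>t. H (- t)) has_real_derivative - H1 (- t)) (at t within {- pi..0})"
      using DERIV_image_chain[of H, OF _ d] H_deriv[OF t'] by (simp only: im o_def) simp
    have "((\<lambda>t. H1 (- t)) has_real_derivative - kernel (- t)) (at t within {- pi..0})"
      using DERIV_image_chain[of H1, OF _ d] H1_deriv[OF t'] by (simp only: im o_def) simp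
    from DERIV_minus[OF this]
    show "((\<lambda>t. - H1 (- t)) has_real_derivative kernel t) (at t within {- pi..0})"
      by (simp add: kernel_minus)
  qed
  have "((\<lambda>u. if u \<in> {0..pi} then H1 u else - H1 (- u)) has_vector_derivative
      (if u \<in> {0..pi} then kernel u else kernel u)) (at u within {- pi..pi})"
    using assms un H1_deriv neg(2)
    by (intro has_vector_derivative_If_within_closures[of u "{0..pi}" "{- pi..0}"])
      (auto simp: cl ins H1_0 has_real_derivative_iff_has_vector_derivative[symmetric])
  then show "(G1 has_real_derivative kernel u) (at u within {- pi..pi})"
    by (simp add: G1_def[abs_def] has_real_derivative_iff_has_vector_derivative)
  have "((\<lambda>u. if u \<in> {0..pi} then H u else H (- u)) has_vector_derivative
      (if u \<in> {0..pi} then H1 u else - H1 (- u))) (at u within {- pi..pi})"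
    using assms un H_deriv neg(1)
    by (intro has_vector_derivative_If_within_closures[of u "{0..pi}" "{- pi..0}"])
      (auto simp: cl ins H1_0 has_real_derivative_iff_has_vector_derivative[symmetric])
  then show "((\<lambda>u. H \<bar>u\<bar>) has_real_derivative G1 u) (at u within {- pi..pi})"
    unfolding has_real_derivative_iff_has_vector_derivative G1_def
    by (rule has_vector_derivative_transform[rotated 2]) (use assms H_abs_eq in auto)
qed

text \<open>The case \<open>k = 1\<close> serves the inner and \<open>k = - 1\<close> the outer integration of \<open>kernel (y - x)\<close> over a
  rectangle.\<close>

lemma shifted_derivs:
  assumes S: "\<And>y. y \<in> S \<Longrightarrow> c + k * y \<in> {- pi..pi}" and y: "y \<in> S"
  shows "((\<lambda>y. G1 (c + k * y)) has_real_derivative k * kernel (c + k * y)) (at y within S)"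
    and "((\<lambda>y. H \<bar>c + k * y\<bar>) has_real_derivative k * G1 (c + k * y)) (at y within S)"
proof -
  have im: "(\<lambda>y. c + k * y) ` S \<subseteq> {- pi..pi}" using S by blast
  have d: "((\<lambda>y. c + k * y) has_real_derivative k) (at y within S)"
    by (auto intro!: derivative_eq_intros)
  show "((\<lambda>y. G1 (c + k * y)) has_real_derivative k * kernel (c + k * y)) (at y within S)"
    using DERIV_image_chain[OF DERIV_subset[OF G1_deriv[OF S[OF y]] im] d] by (simp add: o_def mult.commute)
  show "((\<lambda>y. H \<bar>c + k * y\<bar>) has_real_derivative k * G1 (c + k * y)) (at y within S)"
    using DERIV_image_chain[OF DERIV_subset[OF G_deriv[OF S[OF y]] im] d] by (simp add: o_def mult.commute)
qed

text \<open>Integrate \<open>kernel (y - x)\<close> first in \<open>y\<close> and then in \<open>x\<close>: the antiderivatives are \<open>G1 (y - x)\<close> and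
  \<open>- H \<bar>y - x\<bar>\<close>. The differences \<open>y - x\<close> stay in \<open>[- pi, pi]\<close>, where they are valid.\<close>

lemma has_integral_box:
  assumes "0 \<le> p" "p \<le> q" "q \<le> pi" "0 \<le> r" "r \<le> s" "s \<le> pi"
  shows "has_bochner_integral lborel
    (\<lambda>z. indicator ({p..q} \<times> {r..s}) z * kernel (snd z - fst z))
    (H \<bar>s - p\<bar> - H \<bar>r - p\<bar> - H \<bar>s - q\<bar> + H \<bar>r - q\<bar>)"
proof -
  let ?F = "\<lambda>z. indicator ({p..q} \<times> {r..s}) z * kernel (snd z - fst z)"
  have "integrable lborel (\<lambda>z. indicator ({p..q} \<times> {r..s}) z *\<^sub>R kernel (snd z - fst z))"
    by (intro borel_integrable_compact compact_Times compact_Icc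
        continuous_on_compose2[OF kernel_cont] continuous_intros) auto
  then have int: "integrable (lborel \<Otimes>\<^sub>M lborel) ?F"
    by (simp add: lborel_prod)
  have inner: "(LBINT y. ?F (x, y)) = indicator {p..q} x *\<^sub>R (G1 (s - x) - G1 (r - x))" for x
  proof (cases "x \<in> {p..q}")
    case True
    have "(LBINT y. indicator {r..s} y *\<^sub>R kernel (y - x)) = G1 (s - x) - G1 (r - x)"
    proof (rule integral_FTC_Icc)
      show "continuous_on {r..s} (\<lambda>y. kernel (y - x))"
        by (intro continuous_on_compose2[OF kernel_cont] continuous_intros) auto
      show "((\<lambda>y. G1 (y - x)) has_vector_derivative kernel (y - x)) (at y within {r..s})"
        if "r \<le> y" "y \<le> s" for y
        using shifted_derivs(1)[of "{r..s}" "- x" 1 y] True assms that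
        by (auto simp: has_real_derivative_iff_has_vector_derivative)
    qed (use assms in auto)
    then show ?thesis using True by (simp add: indicator_times)
  qed (simp add: indicator_times)
  have G1_cont: "continuous_on {p..q} (\<lambda>x. G1 (t - x))" if "t \<in> {0..pi}" for t
  proof -
    have "continuous_on {- pi..pi} G1"
      using DERIV_continuous[OF G1_deriv] by (simp add: continuous_on_eq_continuous_within)
    then show ?thesis
      by (rule continuous_on_compose2) (use that assms in \<open>auto intro!: continuous_intros\<close>)
  qed
  have "(LBINT x. indicator {p..q} x *\<^sub>R (G1 (s - x) - G1 (r - x)))
      = (- H \<bar>s - q\<bar> + H \<bar>r - q\<bar>) - (- H \<bar>s - p\<bar> + H \<bar>r - p\<bar>)"
  proof (rule integral_FTC_Icc)
    show "continuous_on {p..q} (\<lambda>x. G1 (s - x) - G1 (r - x))"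
      using assms by (intro continuous_on_diff G1_cont) auto
    show "((\<lambda>x. - H \<bar>s - x\<bar> + H \<bar>r - x\<bar>) has_vector_derivative G1 (s - x) - G1 (r - x)) (at x within {p..q})"
      if "p \<le> x" "x \<le> q" for x
    proof -
      have "((\<lambda>x. H \<bar>t - x\<bar>) has_real_derivative - G1 (t - x)) (at x within {p..q})" if "t \<in> {0..pi}" for t
        using shifted_derivs(2)[of "{p..q}" t "- 1" x] assms that \<open>p \<le> x\<close> \<open>x \<le> q\<close> by auto
      from DERIV_add[OF DERIV_minus[OF this[of s]] this[of r]] assms show ?thesis
        by (simp add: has_real_derivative_iff_has_vector_derivative)
    qed
  qed (use assms in auto)
  then have "integral\<^sup>L (lborel \<Otimes>\<^sub>M lborel) ?F
      = H \<bar>s - p\<bar> - H \<bar>r - p\<bar> - H \<bar>s - q\<bar> + H \<bar>r - q\<bar>"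
    using lborel_pair.integral_fst'[OF int] unfolding inner by simp
  with int show ?thesis
    by (simp add: has_bochner_integral_iff lborel_prod)
qed

text \<open>The arcs of normal angles that occur are half-open; up to this null set they are compact
  intervals.\<close>

lemma AE_coords: "AE z in (lborel :: (real \<times> real) measure). fst z \<notin> {a, b} \<and> snd z \<notin> {a, b}"
proof -
  have "AE z in lborel \<Otimes>\<^sub>M lborel. fst z \<notin> {a, b} \<and> snd z \<notin> {a, b}"
  proof (rule lborel_pair.AE_pair_measure)
    have ae: "AE x in lborel. x \<noteq> a \<and> x \<noteq> b"
      using AE_lborel_singleton[of a] AE_lborel_singleton[of b] by eventually_elim simp
    show "AE x in lborel. AE y in lborel. fst (x, y) \<notin> {a, b} \<and> snd (x, y) \<notin> {a, b}"
      using ae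
    proof eventually_elim
      case (elim x)
      show ?case using ae by eventually_elim (use elim in simp)
    qed
  qed measurable
  then show ?thesis unfolding lborel_prod .
qed

lemma integral_half_turn:
  "(LBINT z. indicator ({0<..<pi} \<times> {0<..<pi}) z * kernel (snd z - fst z)) = 2 * H pi"
proof -
  have "(LBINT z. indicator ({0<..<pi} \<times> {0<..<pi}) z * kernel (snd z - fst z))
      = (LBINT z. indicator ({0..pi} \<times> {0..pi}) z * kernel (snd z - fst z))"
  proof (rule integral_cong_AE)
    show "AE z in lborel. indicator ({0<..<pi} \<times> {0<..<pi}) z * kernel (snd z - fst z)
        = indicator ({0..pi} \<times> {0..pi}) z * kernel (snd z - fst z)"
      using AE_coords[of 0 pi] by eventually_elim (auto simp: indicator_def)
  qed (simp_all add: lborel_prod[symmetric])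
  then show ?thesis
    using has_integral_box[of 0 pi 0 pi] by (simp add: has_bochner_integral_iff H_0)
qed

text \<open>The square of the union of the arcs \<open>[0, m]\<close> and \<open>[M, pi]\<close> consists of four rectangles. The mixed
  ones produce the values of \<open>H\<close> at \<open>pi\<close>, \<open>M\<close>, \<open>pi - m\<close> and \<open>M - m\<close>, which \<open>H_reflect\<close> expresses by
  those at the lengths \<open>pi - M\<close> and \<open>m\<close> of the arcs and at their sum.\<close>

lemma integral_two_arcs:
  assumes "0 \<le> m" "m < M" "M \<le> pi"
  defines "B \<equiv> {0<..m} \<union> {M..<pi}"
  shows "(LBINT z. indicator (B \<times> B) z * kernel (snd z - fst z))
    = 2 * (2 * H (pi - M) + 2 * H m - H (m + pi - M))"
proof -
  let ?I = "\<lambda>p q r s z. indicator ({p..q} \<times> {r..s}) z * kernel (snd z - fst z)"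
  let ?E = "\<lambda>u. H \<bar>u\<bar>"
  have "(LBINT z. indicator (B \<times> B) z * kernel (snd z - fst z))
      = (LBINT z. ?I 0 m 0 m z + ?I 0 m M pi z + (?I M pi 0 m z + ?I M pi M pi z))"
  proof (rule integral_cong_AE)
    show "AE z in lborel. indicator (B \<times> B) z * kernel (snd z - fst z)
        = ?I 0 m 0 m z + ?I 0 m M pi z + (?I M pi 0 m z + ?I M pi M pi z)"
      using AE_coords[of 0 pi]
    proof eventually_elim
      case (elim z)
      have "indicator B x = indicator {0..m} x + (indicator {M..pi} x :: real)" if "x \<notin> {0, pi}" for x
        using assms that by (auto simp: indicator_def)
      with elim show ?case by (simp add: indicator_times distrib_right distrib_left)
    qed
    have [measurable]: "B \<in> sets borel" by (simp add: B_def)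
    show "(\<lambda>z. indicator (B \<times> B) z * kernel (snd z - fst z)) \<in> borel_measurable lborel"
      unfolding lborel_prod[symmetric] by measurable
  qed (simp_all only: lborel_prod[symmetric], measurable)
  also have "\<dots> = (?E (m - 0) - ?E (0 - 0) - ?E (m - m) + ?E (0 - m))
      + (?E (pi - 0) - ?E (M - 0) - ?E (pi - m) + ?E (M - m))
      + ((?E (m - M) - ?E (0 - M) - ?E (m - pi) + ?E (0 - pi))
      + (?E (pi - M) - ?E (M - M) - ?E (pi - pi) + ?E (M - pi)))"
    using assms by (intro has_bochner_integral_integral_eq[OF has_bochner_integral_add[OF
          has_bochner_integral_add[OF has_integral_box has_integral_box]
          has_bochner_integral_add[OF has_integral_box has_integral_box]]]) simp_all
  also have "\<dots> = 2 * (2 * H (pi - M) + 2 * H m - H (m + pi - M))"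
    using assms H_reflect[of M] H_reflect[of m] H_reflect[of "M - m"]
    by (simp add: H_0 abs_if algebra_simps)
  finally show ?thesis .
qed

end

section \<open>The lines through a point that meet the convex set\<close>

lemma height_diff: "height (x - y) \<phi> = height x \<phi> - height y \<phi>"
  and height_add: "height (x + y) \<phi> = height x \<phi> + height y \<phi>"
  and height_scaleR: "height (t *\<^sub>R x) \<phi> = t * height x \<phi>"
  by (simp_all add: height_def algebra_simps)

text \<open>The unit normal at angle \<open>\<phi>\<close> is a linear combination of those at \<open>a\<close> and \<open>b\<close>. Its coefficients are
  positive when \<open>\<phi>\<close> lies between \<open>a\<close> and \<open>b\<close> and \<open>b - a < pi\<close>.\<close>

lemma sin_height_combination:
  "sin (b - a) * height y \<phi> = sin (b - \<phi>) * height y a + sin (\<phi> - a) * height y b"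
  by (simp add: height_def sin_diff algebra_simps)

lemma line_eq: "line p \<phi> = {x. height x \<phi> = p}"
  by (simp add: line_def height_def)

text \<open>On the segment from the origin to a point beyond the line the height takes the value \<open>p\<close>.\<close>

lemma line_meets_iff:
  assumes "convex K" "0 \<in> K" "0 < p"
  shows "line p \<phi> \<inter> K \<noteq> {} \<longleftrightarrow> (\<exists>x\<in>K. p \<le> height x \<phi>)"
proof
  assume "\<exists>x\<in>K. p \<le> height x \<phi>"
  then obtain x where x: "x \<in> K" "p \<le> height x \<phi>" by blast
  have "(p / height x \<phi>) *\<^sub>R x + (1 - p / height x \<phi>) *\<^sub>R 0 \<in> K"
    using assms x by (intro convexD) (auto simp: divide_simps)
  moreover have "height ((p / height x \<phi>) *\<^sub>R x) \<phi> = p"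
    using x assms by (simp add: height_scaleR)
  ultimately show "line p \<phi> \<inter> K \<noteq> {}" by (auto simp: line_eq)
qed (auto simp: line_eq)

text \<open>The normal angles, over the whole real line, of the lines through \<open>P\<close> that meet a convex set
  containing the origin. Leaving the angles unrestricted makes this set periodic.\<close>

definition hitting_directions :: "(real^2) set \<Rightarrow> real^2 \<Rightarrow> real set"
  where "hitting_directions K P = {\<phi>. 0 < height P \<phi> \<and> (\<exists>x\<in>K. height P \<phi> \<le> height x \<phi>)}"

lemma mem_lines_meeting_iff:
  assumes "convex K" "0 \<in> K"
  shows "(height P \<phi>, \<phi>) \<in> lines_meeting K \<longleftrightarrow> \<phi> \<in> {0..<2 * pi} \<inter> hitting_directions K P"
  using line_meets_iff[OF assms] by (auto simp: lines_meeting_def hitting_directions_def)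

text \<open>A projection of a closed set along the compact set \<open>K\<close>.\<close>

lemma closed_hitting:
  assumes "compact K"
  shows "closed {\<phi>. \<exists>x\<in>K. height P \<phi> \<le> height x \<phi>}"
proof -
  have "closed {\<phi>. \<exists>x. x \<in> K \<and> (x, \<phi>) \<in> {z. height P (snd z) \<le> height (fst z) (snd z)}}"
    by (intro closed_compact_projection assms closed_Collect_le continuous_intros)
  then show ?thesis by (simp add: Bex_def)
qed

lemma hitting_directions_borel [measurable]:
  assumes "compact K"
  shows "hitting_directions K P \<in> sets borel"
proof -
  have "open {\<phi>. 0 < height P \<phi>}"
    by (intro open_Collect_less continuous_intros)
  then show ?thesis
    using closed_hitting[OF assms, of P] unfolding hitting_directions_def Collect_conj_eq by auto
qed

text \<open>The condition that a line meets \<open>K\<close> is again a projection along \<open>K\<close> of a closed condition.\<close>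

lemma lines_meeting_borel:
  assumes "compact K"
  shows "lines_meeting K \<in> sets borel"
proof -
  have "closed {z. \<exists>x. x \<in> K \<and> (x, z) \<in> {(x, z). height x (snd z) = fst z}}"
    unfolding split_beta by (intro closed_compact_projection assms closed_Collect_eq continuous_intros)
  then have [measurable]: "{z. \<exists>x\<in>K. height x (snd z) = fst z} \<in> sets borel"
    by (auto simp: Bex_def)
  have "lines_meeting K = ({0<..} \<times> {0..<2 * pi}) \<inter> {z. \<exists>x\<in>K. height x (snd z) = fst z}"
    by (auto simp: lines_meeting_def line_eq)
  also have "\<dots> \<in> sets borel"
    by (intro sets.Int borel_Times) simp_all
  finally show ?thesis .
qed

lemma height_le_norm: "height x \<phi> \<le> norm x"
proof -
  have "height x \<phi> = x \<bullet> vector [cos \<phi>, sin \<phi>]"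
    by (simp add: height_def inner_2')
  also have "\<dots> \<le> norm x * norm (vector [cos \<phi>, sin \<phi>] :: real^2)"
    by (rule norm_cauchy_schwarz)
  also have "norm (vector [cos \<phi>, sin \<phi>] :: real^2) = 1"
    by (simp add: norm_vec_def L2_set_def sum_2)
  finally show ?thesis by simp
qed

lemma lines_meeting_bounded:
  assumes "bounded K"
  obtains B where "lines_meeting K \<subseteq> {0..B} \<times> {0..2 * pi}"
proof -
  from assms obtain B where B: "\<And>x. x \<in> K \<Longrightarrow> norm x \<le> B" by (auto simp: bounded_iff)
  have "lines_meeting K \<subseteq> {0..B} \<times> {0..2 * pi}"
    using B height_le_norm by (fastforce simp: lines_meeting_def line_eq intro: order_trans)
  then show ?thesis by (rule that)
qed

lemma interior_height_pos:
  assumes "0 \<in> interior K"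
  obtains x where "x \<in> K" "0 < height x \<phi>"
proof -
  from assms obtain e where e: "e > 0" "ball 0 e \<subseteq> K" by (auto simp: mem_interior)
  define x :: "real^2" where "x = (e / 2) *\<^sub>R vector [cos \<phi>, sin \<phi>]"
  have "norm (vector [cos \<phi>, sin \<phi>] :: real^2) = 1"
    by (simp add: norm_vec_def L2_set_def sum_2)
  then have "x \<in> K" using e by (auto simp: x_def intro!: subsetD[OF e(2)])
  moreover have "height x \<phi> = e / 2"
    by (simp add: x_def height_scaleR) (simp add: height_def power2_eq_square[symmetric])
  ultimately show ?thesis using that e by simp
qed

text \<open>The angle \<open>c\<close> is the polar angle of \<open>ref_dir P\<close>; normal angles will be measured from it.\<close>

lemma ref_dir_angle:
  fixes P :: "real^2"
  assumes "P \<noteq> 0"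
  obtains c where "0 \<le> c" "c < 2 * pi" "P $ 1 = - norm P * sin c" "P $ 2 = norm P * cos c"
proof -
  have "(P $ 2 / norm P)\<^sup>2 + (- P $ 1 / norm P)\<^sup>2 = 1"
    using normalised_nth[OF assms] by (simp add: power2_eq_square)
  then obtain c where "0 \<le> c" "c < 2 * pi" "P $ 2 / norm P = cos c" "- P $ 1 / norm P = sin c"
    using sincos_total_2pi by metis
  then show ?thesis using assms by (intro that[of c]) (auto simp: field_simps)
qed

context
  fixes P :: "real^2" and c :: real
  assumes P0: "P \<noteq> 0" and P1: "P $ 1 = - norm P * sin c" and P2: "P $ 2 = norm P * cos c"
begin

lemma height_rotated: "height P (c + \<gamma>) = norm P * sin \<gamma>"
proof -
  have "norm P * sin (c + \<gamma> - c) = height P (c + \<gamma>)"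
    unfolding sin_diff height_def P1 P2 by (simp add: algebra_simps)
  then show ?thesis by simp
qed

lemma unit_dir_rotated: "unit_dir P \<gamma> $ 1 = cos (c + \<gamma>)" "unit_dir P \<gamma> $ 2 = sin (c + \<gamma>)"
proof -
  have "P $ 1 / norm P = - sin c" "P $ 2 / norm P = cos c"
    using P0 P1 P2 by (simp_all add: field_simps)
  then show "unit_dir P \<gamma> $ 1 = cos (c + \<gamma>)" "unit_dir P \<gamma> $ 2 = sin (c + \<gamma>)"
    unfolding unit_dir_nth add_divide_distrib diff_divide_distrib times_divide_eq_right[symmetric]
    by (simp_all add: cos_add sin_add mult.commute)
qed

lemma height_unit_dir: "height (unit_dir P \<gamma>) \<phi> = cos (c + \<gamma> - \<phi>)"
  by (simp add: height_def unit_dir_rotated cos_diff)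

text \<open>The hypothesis says that the normal at angle \<open>\<nu>\<close> is perpendicular to \<open>unit_dir P \<gamma>\<close>.\<close>

lemma line_through_eq_line:
  assumes "cos (c + \<gamma> - \<nu>) = 0"
  shows "line_through P (unit_dir P \<gamma>) = {x. height x \<nu> = height P \<nu>}"
proof
  show "line_through P (unit_dir P \<gamma>) \<subseteq> {x. height x \<nu> = height P \<nu>}"
    using assms by (auto simp: line_through_def height_add height_scaleR height_unit_dir)
  show "{x. height x \<nu> = height P \<nu>} \<subseteq> line_through P (unit_dir P \<gamma>)"
  proof
    fix x assume "x \<in> {x. height x \<nu> = height P \<nu>}"
    then have x: "height (x - P) \<nu> = 0" by (simp add: height_diff)
    define a b u v t where d: "a = (x - P) $ 1" "b = (x - P) $ 2" "u = cos (c + \<gamma>)" "v = sin (c + \<gamma>)"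
      "t = a * u + b * v"
    have "a * cos \<nu> + b * sin \<nu> = 0" "u * cos \<nu> + v * sin \<nu> = 0"
      using x assms unfolding d cos_diff[of "c + \<gamma>"] height_def by simp_all
    moreover have "u * u + v * v = 1" "cos \<nu> * cos \<nu> + sin \<nu> * sin \<nu> = 1"
      by (simp_all add: d power2_eq_square[symmetric])
    ultimately have "a = t * u" "b = t * v"
      unfolding d(5) by algebra+
    then have "x = P + t *\<^sub>R unit_dir P \<gamma>"
      unfolding d by (simp add: vec_eq_iff forall_2 unit_dir_rotated)
    then show "x \<in> line_through P (unit_dir P \<gamma>)" by (auto simp: line_through_def)
  qed
qed

text \<open>The line through \<open>P\<close> with normal angle \<open>\<nu>\<close> supports \<open>K\<close> and touches it at \<open>Q\<close>. That \<open>Q\<close> lies on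
  the half-line from \<open>P\<close> opposite to \<open>unit_dir P \<gamma>\<close> is recognised from a second normal angle \<open>\<phi>\<close>, for
  which \<open>Q\<close> is strictly below \<open>P\<close>, whereas \<open>unit_dir P \<gamma>\<close> points upwards.\<close>

lemma support_angleI:
  assumes K: "\<And>x. x \<in> K \<Longrightarrow> height x \<nu> \<le> height P \<nu>"
    and Q: "Q \<in> K" "height Q \<nu> = height P \<nu>"
    and perp: "cos (c + \<gamma> - \<nu>) = 0"
    and \<phi>: "height Q \<phi> < height P \<phi>" "0 < cos (c + \<gamma> - \<phi>)"
  shows "support_angle K P \<gamma>"
proof -
  define n :: "real^2" where "n = vector [cos \<nu>, sin \<nu>]"
  have n: "n \<bullet> x = height x \<nu>" for x
    by (simp add: n_def inner_2' height_def mult.commute)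
  have "norm n = 1"
    by (simp add: n_def norm_vec_def L2_set_def sum_2)
  then have "n \<noteq> 0" by auto
  then have supp: "support_line K (line_through P (unit_dir P \<gamma>))"
    unfolding support_line_def line_through_eq_line[OF perp] using K Q
    by (intro exI[of _ n] exI[of _ "height P \<nu>"]) (auto simp: n)
  have "Q \<in> line_through P (unit_dir P \<gamma>)"
    using Q by (simp add: line_through_eq_line[OF perp])
  then obtain s where s: "Q = P + s *\<^sub>R unit_dir P \<gamma>" by (auto simp: line_through_def)
  then have "s * cos (c + \<gamma> - \<phi>) < 0"
    using \<phi>(1) by (simp add: height_add height_scaleR height_unit_dir)
  then have "- s > 0" using \<phi>(2) by (simp add: mult_less_0_iff)
  moreover have "P - (- s) *\<^sub>R unit_dir P \<gamma> \<in> K" using s Q by simp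
  ultimately show ?thesis using supp unfolding support_angle_def by blast
qed

text \<open>A hyperplane strictly separating \<open>P\<close> from \<open>K\<close>, described by the angle of its normal. This angle can
  be taken in \<open>(0, pi)\<close> since \<open>P\<close> lies higher than the origin, which is a point of \<open>K\<close>.\<close>

lemma separating_direction:
  assumes "closed K" "convex K" "P \<notin> K" "0 \<in> K"
  obtains \<gamma> where "0 < \<gamma>" "\<gamma> < pi" "\<And>x. x \<in> K \<Longrightarrow> height x (c + \<gamma>) < height P (c + \<gamma>)"
proof -
  obtain a b where ab: "a \<bullet> P < b" "\<And>x. x \<in> K \<Longrightarrow> b < a \<bullet> x"
    using separating_hyperplane_closed_point[OF assms(2,1,3)] by blast
  have "a \<noteq> 0" using ab(1) ab(2)[OF assms(4)] by auto
  then obtain d where d: "a $ 1 = - norm a * sin d" "a $ 2 = norm a * cos d"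
    by (rule ref_dir_angle)
  \<comment> \<open>The outer normal \<open>- a\<close> has the angle \<open>d - pi / 2\<close>; it is taken relative to \<open>c\<close> and reduced
    modulo \<open>2 * pi\<close>.\<close>
  have "\<exists>\<gamma>\<in>{0..<2*pi}. \<exists>k::int. d - pi / 2 - c = \<gamma> + 2 * pi * k"
  proof
    show "\<exists>k::int. d - pi / 2 - c = (d - pi / 2 - c - 2 * pi * \<lfloor>(d - pi / 2 - c) / (2 * pi)\<rfloor>) + 2 * pi * k"
      by (intro exI[of _ "\<lfloor>(d - pi / 2 - c) / (2 * pi)\<rfloor>"]) simp
    show "d - pi / 2 - c - 2 * pi * \<lfloor>(d - pi / 2 - c) / (2 * pi)\<rfloor> \<in> {0..<2*pi}"
      using floor_divide_lower[of "2 * pi" "d - pi / 2 - c"] floor_divide_upper[of "2 * pi" "d - pi / 2 - c"]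
      by (simp add: algebra_simps)
  qed
  then obtain \<gamma> k where \<gamma>: "0 \<le> \<gamma>" "\<gamma> < 2 * pi" "d - pi / 2 - c = \<gamma> + 2 * pi * of_int k" by auto
  have "c + \<gamma> = d - pi / 2 - 2 * pi * of_int k" using \<gamma>(3) by simp
  then have cs: "cos (c + \<gamma>) = sin d" "sin (c + \<gamma>) = - cos d"
    by (simp_all add: cos_diff sin_diff cos_int_2pin sin_int_2pin)
  have h: "norm a * height x (c + \<gamma>) = - (a \<bullet> x)" for x
    unfolding height_def cs inner_2' d by (simp add: algebra_simps)
  have lt: "height x (c + \<gamma>) < height P (c + \<gamma>)" if "x \<in> K" for x
  proof -
    have "norm a * height x (c + \<gamma>) < norm a * height P (c + \<gamma>)"
      using ab(1) ab(2)[OF that] unfolding h by simp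
    then show ?thesis using \<open>a \<noteq> 0\<close> by simp
  qed
  have "0 < sin \<gamma>"
    using lt[OF assms(4)] P0 by (simp add: height_rotated) (simp add: height_def zero_less_mult_iff)
  then have "0 < \<gamma>" "\<gamma> < pi"
    using \<gamma>(1,2) sin_le_zero[of \<gamma>] by (cases "\<gamma> = 0"; force)+
  then show ?thesis using lt that by blast
qed

text \<open>The set \<open>D\<close> of normals that separate \<open>P\<close> strictly from \<open>K\<close> is open by compactness of \<open>K\<close>, and any
  angle between two members is a member by \<open>sin_height_combination\<close>; so it is an open interval
  \<open>(m, M)\<close>. At its ends the strict inequality becomes a weak one that is not strict for all points of
  \<open>K\<close>, so the lines through \<open>P\<close> with these normals are support lines. Turning the normal at \<open>m\<close> by
  \<open>pi / 2\<close>, or the one at \<open>M\<close> by \<open>- pi / 2\<close>, gives the direction of the line, hence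
  \<open>\<beta> = m + pi / 2\<close> and \<open>\<alpha> = M - pi / 2\<close>.\<close>

lemma missing_directions_interval:
  assumes "compact K" "convex K" "0 \<in> interior K" "P \<notin> K"
  obtains m M where "0 < m" "m < M" "M < pi"
    "\<And>\<gamma>. 0 < \<gamma> \<Longrightarrow> \<gamma> < pi \<Longrightarrow>
      (\<exists>x\<in>K. height P (c + \<gamma>) \<le> height x (c + \<gamma>)) \<longleftrightarrow> \<gamma> \<notin> {m<..<M}"
    "visual_angle1 K P = pi - M" "visual_angle2 K P = m"
proof -
  have "0 \<in> K" using assms(3) interior_subset by blast
  define U where "U = {\<gamma>. \<forall>x\<in>K. height x (c + \<gamma>) < height P (c + \<gamma>)}"
  define D where "D = U \<inter> {0<..<pi}"
  have U_compl: "- U = (\<lambda>\<gamma>. c + \<gamma>) -` {\<phi>. \<exists>x\<in>K. height P \<phi> \<le> height x \<phi>}"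
    by (auto simp: U_def not_less)
  have "closed (- U)"
    unfolding U_compl by (intro closed_vimage closed_hitting assms continuous_intros)
  then have "open U" by (simp only: open_closed)
  then have "open D" unfolding D_def by (intro open_Int open_greaterThanLessThan)
  have pos: "0 < sin \<gamma>" if "\<gamma> \<in> U" for \<gamma>
  proof -
    have "height 0 (c + \<gamma>) < height P (c + \<gamma>)" using that \<open>0 \<in> K\<close> by (auto simp: U_def)
    then show ?thesis
      using P0 by (simp add: height_rotated) (simp add: height_def zero_less_mult_iff)
  qed
  obtain \<gamma>0 where "0 < \<gamma>0" "\<gamma>0 < pi" "\<And>x. x \<in> K \<Longrightarrow> height x (c + \<gamma>0) < height P (c + \<gamma>0)"
    using separating_direction[OF compact_imp_closed[OF assms(1)] assms(2,4) \<open>0 \<in> K\<close>] by blast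
  then have \<gamma>0: "\<gamma>0 \<in> D" by (simp add: D_def U_def)
  have bdd: "bdd_below D" "bdd_above D"
    by (auto simp: D_def intro!: bdd_belowI[of _ 0] bdd_aboveI[of _ pi])
  have between: "\<gamma> \<in> D" if ab: "a \<in> D" "b \<in> D" "a < \<gamma>" "\<gamma> < b" for a b \<gamma>
  proof -
    have "height x (c + \<gamma>) < height P (c + \<gamma>)" if "x \<in> K" for x
    proof -
      have s: "sin (b - a) > 0" "sin (b - \<gamma>) > 0" "sin (\<gamma> - a) > 0"
        using ab by (auto simp: D_def intro!: sin_gt_zero)
      have comb: "sin (b - a) * height y (c + \<gamma>)
          = sin (b - \<gamma>) * height y (c + a) + sin (\<gamma> - a) * height y (c + b)" for y
        using sin_height_combination[of "c + b" "c + a" y "c + \<gamma>"] by simp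
      have "height x (c + a) < height P (c + a)" "height x (c + b) < height P (c + b)"
        using ab that by (auto simp: D_def U_def)
      then have "sin (b - a) * height x (c + \<gamma>) < sin (b - a) * height P (c + \<gamma>)"
        unfolding comb using s by (intro add_strict_mono mult_strict_left_mono)
      then show ?thesis using s by simp
    qed
    then show ?thesis using ab by (auto simp: D_def U_def)
  qed
  define m M where mM: "m = Inf D" "M = Sup D"
  have D_eq: "D = {m<..<M}"
  proof
    show "D \<subseteq> {m<..<M}"
    proof
      fix x assume x: "x \<in> D"
      then obtain e where e: "e > 0" "ball x e \<subseteq> D" using \<open>open D\<close> by (auto simp: open_contains_ball)
      have "x - e / 2 \<in> D" "x + e / 2 \<in> D"
        using e(1) by (auto intro!: subsetD[OF e(2)] simp: dist_real_def)
      then have "m \<le> x - e / 2" "x + e / 2 \<le> M"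
        unfolding mM using bdd by (auto intro: cInf_lower cSup_upper)
      then show "x \<in> {m<..<M}" using e by auto
    qed
    show "{m<..<M} \<subseteq> D"
    proof
      fix x assume "x \<in> {m<..<M}"
      then have "Inf D < x" "x < Sup D" by (auto simp: mM)
      then obtain a b where "a \<in> D" "a < x" "b \<in> D" "x < b"
        using cInf_less_iff[of D x] less_cSup_iff[of D x] bdd \<gamma>0 by blast
      then show "x \<in> D" using between by blast
    qed
  qed
  have "m < M" using \<gamma>0 D_eq by auto
  have "m \<ge> 0" "M \<le> pi"
    using \<gamma>0 unfolding mM by (auto intro!: cInf_greatest cSup_least simp: D_def)
  have weak: "height x (c + \<gamma>) \<le> height P (c + \<gamma>)" if "x \<in> K" "\<gamma> \<in> {m..M}" for x \<gamma>
  proof -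
    have "closed {\<gamma>. height x (c + \<gamma>) \<le> height P (c + \<gamma>)}"
      by (intro closed_Collect_le continuous_intros)
    moreover have "{m<..<M} \<subseteq> {\<gamma>. height x (c + \<gamma>) \<le> height P (c + \<gamma>)}"
      using that by (auto simp: D_eq[symmetric] D_def U_def less_imp_le)
    ultimately have "closure {m<..<M} \<subseteq> {\<gamma>. height x (c + \<gamma>) \<le> height P (c + \<gamma>)}"
      by (rule closure_minimal[rotated])
    then show ?thesis using that \<open>m < M\<close> by auto
  qed
  \<comment> \<open>The line \<open>O P\<close> is no support line because the origin is an interior point; this keeps \<open>m\<close> and
    \<open>M\<close> away from \<open>0\<close> and \<open>pi\<close>.\<close>
  have nonzero: "sin \<gamma> \<noteq> 0" if "\<gamma> \<in> {m..M}" for \<gamma>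
  proof
    assume "sin \<gamma> = 0"
    obtain x where "x \<in> K" "0 < height x (c + \<gamma>)" using interior_height_pos[OF assms(3)] by blast
    then show False using weak[OF _ that, of x] \<open>sin \<gamma> = 0\<close> by (simp add: height_rotated)
  qed
  have "0 < m" using nonzero[of m] \<open>m \<ge> 0\<close> \<open>m < M\<close> by (cases "m = 0") auto
  have "M < pi" using nonzero[of M] \<open>M \<le> pi\<close> \<open>m < M\<close> by (cases "M = pi") auto
  have touch: "\<exists>Q\<in>K. height Q (c + \<gamma>) = height P (c + \<gamma>)" if "\<gamma> = m \<or> \<gamma> = M" for \<gamma>
  proof -
    have "\<gamma> \<notin> D" "\<gamma> \<in> {0<..<pi}" "\<gamma> \<in> {m..M}"
      using that D_eq \<open>0 < m\<close> \<open>M < pi\<close> \<open>m < M\<close> by auto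
    then obtain Q where "Q \<in> K" "\<not> height Q (c + \<gamma>) < height P (c + \<gamma>)"
      by (auto simp: D_def U_def)
    with weak[of Q \<gamma>] \<open>\<gamma> \<in> {m..M}\<close> show ?thesis by (intro bexI[of _ Q]) auto
  qed
  \<comment> \<open>Any separating angle would do as the second normal in \<open>support_angleI\<close>.\<close>
  define \<mu> where "\<mu> = (m + M) / 2"
  have \<mu>: "m < \<mu>" "\<mu> < M" using \<open>m < M\<close> by (auto simp: \<mu>_def)
  then have \<mu>D: "height x (c + \<mu>) < height P (c + \<mu>)" if "x \<in> K" for x
    using that D_eq by (auto simp: D_def U_def)
  have "support_angle K P (m + pi / 2)"
  proof -
    obtain Q where "Q \<in> K" "height Q (c + m) = height P (c + m)" using touch by blast
    moreover have "cos (c + (m + pi / 2) - (c + \<mu>)) = sin (\<mu> - m)"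
      using sin_cos_eq[of "\<mu> - m"] by (simp add: algebra_simps)
    moreover have "sin (\<mu> - m) > 0" using \<mu> \<open>0 < m\<close> \<open>M < pi\<close> by (intro sin_gt_zero) auto
    ultimately show ?thesis
      using weak \<mu>D \<open>m < M\<close> by (intro support_angleI[of K "c + m" Q _ "c + \<mu>"]) auto
  qed
  then have "angle_beta K P = m + pi / 2"
    using \<open>0 \<in> K\<close> P0 \<open>0 < m\<close> \<open>m < M\<close> \<open>M < pi\<close> by (intro angle_beta_eq) auto
  moreover have "support_angle K P (M - pi / 2)"
  proof -
    obtain Q where "Q \<in> K" "height Q (c + M) = height P (c + M)" using touch by blast
    moreover have "cos (c + (M - pi / 2) - (c + \<mu>)) = sin (M - \<mu>)"
      using cos_minus[of "pi / 2 - (M - \<mu>)"] sin_cos_eq[of "M - \<mu>"] by (simp add: algebra_simps)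
    moreover have "sin (M - \<mu>) > 0" using \<mu> \<open>0 < m\<close> \<open>M < pi\<close> by (intro sin_gt_zero) auto
    ultimately show ?thesis
      using weak \<mu>D \<open>m < M\<close> by (intro support_angleI[of K "c + M" Q _ "c + \<mu>"]) auto
  qed
  then have "angle_alpha K P = M - pi / 2"
    using \<open>0 \<in> K\<close> P0 \<open>0 < m\<close> \<open>m < M\<close> \<open>M < pi\<close> by (intro angle_alpha_eq) auto
  moreover have "(\<exists>x\<in>K. height P (c + \<gamma>) \<le> height x (c + \<gamma>)) \<longleftrightarrow> \<gamma> \<notin> {m<..<M}" if "0 < \<gamma>" "\<gamma> < pi" for \<gamma>
    using that unfolding D_eq[symmetric] by (auto simp: D_def U_def not_less)
  ultimately show ?thesis
    using \<open>0 < m\<close> \<open>m < M\<close> \<open>M < pi\<close> by (intro that) (auto simp: visual_angle1_def visual_angle2_def)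
qed

end

section \<open>Rotation of the normal angles\<close>

text \<open>Arc length on the circle, modelled on \<open>[0, 2 * pi)\<close>; it is invariant under rotations modulo
  \<open>2 * pi\<close>.\<close>

definition circle_measure :: "real measure"
  where "circle_measure = density lborel (indicator {0..<2 * pi})"

definition rotate :: "real \<Rightarrow> real \<Rightarrow> real"
  where "rotate c x = (if x + c < 2 * pi then x + c else x + c - 2 * pi)"

lemma borel_measurable_rotate [measurable]: "rotate c \<in> borel_measurable borel"
  unfolding rotate_def by measurable

lemma sets_circle_measure [measurable_cong, simp]: "sets circle_measure = sets borel"
  by (simp add: circle_measure_def)

lemma sigma_finite_circle_measure: "sigma_finite_measure circle_measure"
proof -
  have "finite_measure circle_measure"
    by standard (simp add: circle_measure_def emeasure_density)
  then show ?thesis by (rule finite_measure.axioms)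
qed

lemma nn_integral_real_shift:
  fixes k :: "real \<Rightarrow> ennreal"
  assumes "k \<in> borel_measurable borel"
  shows "(\<integral>\<^sup>+x. k (x + t) \<partial>lborel) = (\<integral>\<^sup>+x. k x \<partial>lborel)"
  using nn_integral_real_linear[OF assms, of 1 t] by simp

text \<open>Rotation by \<open>c\<close> translates \<open>[0, 2 * pi - c)\<close> onto \<open>[c, 2 * pi)\<close> and the remaining part onto
  \<open>[0, c)\<close>.\<close>

lemma distr_circle_measure_rotate:
  assumes "0 \<le> c" "c < 2 * pi"
  shows "distr circle_measure borel (rotate c) = circle_measure"
proof (rule measure_eqI)
  fix A :: "real set"
  assume "A \<in> sets (distr circle_measure borel (rotate c))"
  then have [measurable]: "A \<in> sets borel" by simp
  have "emeasure (distr circle_measure borel (rotate c)) A = (\<integral>\<^sup>+x. indicator A (rotate c x) \<partial>circle_measure)"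
    by (subst nn_integral_indicator[symmetric], simp, subst nn_integral_distr) simp_all
  also have "\<dots> = (\<integral>\<^sup>+x. indicator {0..<2 * pi} x * indicator A (rotate c x) \<partial>lborel)"
    unfolding circle_measure_def by (subst nn_integral_density) simp_all
  also have "\<dots> = (\<integral>\<^sup>+x. indicator ({c..<2 * pi} \<inter> A) (x + c)
      + indicator ({0..<c} \<inter> A) (x + (c - 2 * pi)) \<partial>lborel)"
    using assms by (intro nn_integral_cong) (auto simp: rotate_def indicator_def add_diff_eq)
  also have "\<dots> = (\<integral>\<^sup>+x. indicator ({c..<2 * pi} \<inter> A) (x + c) \<partial>lborel)
      + (\<integral>\<^sup>+x. indicator ({0..<c} \<inter> A) (x + (c - 2 * pi)) \<partial>lborel)"
    by (rule nn_integral_add) measurable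
  also have "\<dots> = (\<integral>\<^sup>+x. indicator ({c..<2 * pi} \<inter> A) x \<partial>lborel) + (\<integral>\<^sup>+x. indicator ({0..<c} \<inter> A) x \<partial>lborel)"
    by (subst (1 2) nn_integral_real_shift) simp_all
  also have "\<dots> = (\<integral>\<^sup>+x. indicator ({c..<2 * pi} \<inter> A) x + indicator ({0..<c} \<inter> A) x \<partial>lborel)"
    by (rule nn_integral_add[symmetric]) measurable
  also have "\<dots> = (\<integral>\<^sup>+x. indicator {0..<2 * pi} x * indicator A x \<partial>lborel)"
    using assms by (intro nn_integral_cong) (auto simp: indicator_def)
  also have "\<dots> = (\<integral>\<^sup>+x. indicator A x \<partial>circle_measure)"
    unfolding circle_measure_def by (subst nn_integral_density) simp_all
  finally show "emeasure (distr circle_measure borel (rotate c)) A = emeasure circle_measure A"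
    by simp
qed simp

text \<open>The product of the circle measure with itself is invariant under rotating both coordinates, and
  for a periodic function the reduction modulo \<open>2 * pi\<close> makes no difference. Working with measures
  keeps this free of integrability conditions.\<close>

lemma integral_rotate:
  fixes h :: "real \<times> real \<Rightarrow> real"
  assumes [measurable]: "h \<in> borel_measurable borel"
    and per1: "\<And>x y. h (x - 2 * pi, y) = h (x, y)" and per2: "\<And>x y. h (x, y - 2 * pi) = h (x, y)"
    and c: "0 \<le> c" "c < 2 * pi"
  shows "(LBINT z. indicator ({0..<2 * pi} \<times> {0..<2 * pi}) z * h z)
    = (LBINT z. indicator ({0..<2 * pi} \<times> {0..<2 * pi}) z * h (c + fst z, c + snd z))"
proof -
  have [measurable]: "h \<in> borel_measurable (borel \<Otimes>\<^sub>M borel)" by (simp add: borel_prod)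
  interpret sigma_finite_measure circle_measure by (rule sigma_finite_circle_measure)
  define \<mu> where "\<mu> = circle_measure \<Otimes>\<^sub>M circle_measure"
  have [measurable_cong]: "sets \<mu> = sets (borel \<Otimes>\<^sub>M borel)"
    unfolding \<mu>_def by (rule sets_pair_measure_cong) simp_all
  have dens: "integral\<^sup>L \<mu> k = (LBINT z. indicator ({0..<2 * pi} \<times> {0..<2 * pi}) z * k z)"
    if [measurable]: "k \<in> borel_measurable (borel \<Otimes>\<^sub>M borel)" for k :: "real \<times> real \<Rightarrow> real"
  proof -
    have [measurable]: "k \<in> borel_measurable borel" using that by (simp add: borel_prod)
    have "\<mu> = density (lborel \<Otimes>\<^sub>M lborel) (\<lambda>(x, y). indicator {0..<2 * pi} x * indicator {0..<2 * pi} y)"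
      unfolding \<mu>_def circle_measure_def using sigma_finite_circle_measure
      by (intro pair_measure_density) (simp_all add: circle_measure_def lborel.sigma_finite_measure_axioms)
    also have "\<dots> = density lborel (\<lambda>z. ennreal (indicator ({0..<2 * pi} \<times> {0..<2 * pi}) z))"
      unfolding lborel_prod by (intro arg_cong2[of _ _ _ _ density]) (auto simp: fun_eq_iff indicator_def)
    finally have "integral\<^sup>L \<mu> k = integral\<^sup>L \<dots> k" by simp
    also have "\<dots> = (LBINT z. indicator ({0..<2 * pi} \<times> {0..<2 * pi}) z * k z)"
      by (subst integral_density) (simp_all add: lborel_prod[symmetric])
    finally show ?thesis .
  qed
  have "\<mu> = distr \<mu> (borel \<Otimes>\<^sub>M borel) (\<lambda>(x, y). (rotate c x, rotate c y))"
    unfolding \<mu>_def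
    using pair_measure_distr[of "rotate c" circle_measure borel "rotate c" circle_measure borel]
    by (simp add: distr_circle_measure_rotate[OF c] sigma_finite_circle_measure)
  then have "integral\<^sup>L \<mu> h = integral\<^sup>L (distr \<mu> (borel \<Otimes>\<^sub>M borel) (\<lambda>(x, y). (rotate c x, rotate c y))) h"
    by simp
  also have "\<dots> = integral\<^sup>L \<mu> (\<lambda>z. h (rotate c (fst z), rotate c (snd z)))"
    by (subst integral_distr) (simp_all add: split_beta)
  also have "(\<lambda>z. h (rotate c (fst z), rotate c (snd z))) = (\<lambda>z. h (c + fst z, c + snd z))"
    by (auto simp: fun_eq_iff rotate_def per1 per2 add.commute)
  finally show ?thesis by (simp add: dens)
qed

lemma hitting_directions_periodic:
  "\<phi> - 2 * pi \<in> hitting_directions K P \<longleftrightarrow> \<phi> \<in> hitting_directions K P"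
proof -
  have "height x (\<phi> - 2 * pi) = height x \<phi>" for x
    by (simp add: height_def cos_diff sin_diff)
  then show ?thesis by (simp add: hitting_directions_def)
qed

context angle_kernel
begin

text \<open>The contribution of the pairs of lines that meet \<open>K\<close> and intersect at \<open>P\<close>.\<close>

definition point_density :: "(real^2) set \<Rightarrow> real^2 \<Rightarrow> real"
  where "point_density K P =
    (LBINT z. indicator ({0..<2 * pi} \<times> {0..<2 * pi}) z
       * (indicator (hitting_directions K P \<times> hitting_directions K P) z * kernel (snd z - fst z)))"

lemma point_density_rotated:
  assumes "compact K"
    and "0 \<le> c" "c < 2 * pi"
    and B: "B \<subseteq> {0..<2 * pi}" "\<And>\<gamma>. \<gamma> \<in> {0..<2 * pi} \<Longrightarrow> c + \<gamma> \<in> hitting_directions K P \<longleftrightarrow> \<gamma> \<in> B"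
  shows "point_density K P = (LBINT z. indicator (B \<times> B) z * kernel (snd z - fst z))"
proof -
  let ?A = "hitting_directions K P"
  have [measurable]: "?A \<in> sets borel" by (rule hitting_directions_borel[OF assms(1)])
  have "point_density K P = (LBINT z. indicator ({0..<2 * pi} \<times> {0..<2 * pi}) z
      * (indicator (?A \<times> ?A) (c + fst z, c + snd z) * kernel (snd (c + fst z, c + snd z) - fst (c + fst z, c + snd z))))"
    unfolding point_density_def
  proof (rule integral_rotate)
    show "(\<lambda>z. indicator (?A \<times> ?A) z * kernel (snd z - fst z)) \<in> borel_measurable borel"
      unfolding borel_prod[symmetric] by measurable
    show "indicator (?A \<times> ?A) (x - 2 * pi, y) * kernel (snd (x - 2 * pi, y) - fst (x - 2 * pi, y))
      = indicator (?A \<times> ?A) (x, y) * kernel (snd (x, y) - fst (x, y))" for x y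
    proof -
      have "y - (x - 2 * pi) = y - x + 2 * pi" by simp
      then show ?thesis
        by (simp only: fst_conv snd_conv indicator_def mem_Times_iff hitting_directions_periodic kernel_periodic)
    qed
    show "indicator (?A \<times> ?A) (x, y - 2 * pi) * kernel (snd (x, y - 2 * pi) - fst (x, y - 2 * pi))
      = indicator (?A \<times> ?A) (x, y) * kernel (snd (x, y) - fst (x, y))" for x y
    proof -
      have "y - 2 * pi - x = y - x - 2 * pi" by simp
      then show ?thesis
        by (simp only: fst_conv snd_conv indicator_def mem_Times_iff hitting_directions_periodic kernel_periodic)
    qed
  qed (use assms in auto)
  also have "\<dots> = (LBINT z. indicator (B \<times> B) z * kernel (snd z - fst z))"
    using B by (intro Bochner_Integration.integral_cong refl) (auto simp: indicator_def)
  finally show ?thesis .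
qed

section \<open>The contribution of a point to the integral\<close>

text \<open>Relative to the angle of \<open>ref_dir P\<close>, the height of \<open>P\<close> is \<open>norm P * sin \<gamma>\<close>, so the relevant
  angles are those in \<open>(0, pi)\<close>. All of them occur if \<open>P \<in> K\<close>; otherwise the interval of
  \<open>missing_directions_interval\<close> has to be removed, which leaves two arcs of lengths \<open>\<omega>2\<close> and \<open>\<omega>1\<close>.\<close>

lemma
  assumes K: "compact K" "convex K" "0 \<in> interior K" and "P \<noteq> 0"
  shows point_density_inside: "P \<in> K \<Longrightarrow> point_density K P = 2 * H pi"
    and point_density_outside: "P \<notin> K \<Longrightarrow> point_density K P
      = 2 * (2 * H (visual_angle1 K P) + 2 * H (visual_angle2 K P) - H (visual_angle K P))"
proof -
  obtain c where c: "0 \<le> c" "c < 2 * pi" and P: "P $ 1 = - norm P * sin c" "P $ 2 = norm P * cos c"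
    using ref_dir_angle[OF \<open>P \<noteq> 0\<close>] by blast
  note rotated = height_rotated[OF \<open>P \<noteq> 0\<close> P]
  have pos: "0 < height P (c + \<gamma>) \<longleftrightarrow> \<gamma> \<in> {0<..<pi}" if "\<gamma> \<in> {0..<2 * pi}" for \<gamma>
  proof -
    have "0 < sin \<gamma> \<longleftrightarrow> \<gamma> \<in> {0<..<pi}"
    proof (cases "\<gamma> \<in> {0<..<pi}")
      case False
      then have "\<gamma> = 0 \<or> pi \<le> \<gamma> \<and> \<gamma> < 2 * pi" using that by auto
      then have "sin \<gamma> \<le> 0" using sin_le_zero by auto
      with False show ?thesis by simp
    qed (simp add: sin_gt_zero)
    then show ?thesis using \<open>P \<noteq> 0\<close> by (simp add: rotated zero_less_mult_iff)
  qed
  show "point_density K P = 2 * H pi" if "P \<in> K"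
  proof -
    have "point_density K P = (LBINT z. indicator ({0<..<pi} \<times> {0<..<pi}) z * kernel (snd z - fst z))"
    proof (rule point_density_rotated[OF K(1) c])
      show "c + \<gamma> \<in> hitting_directions K P \<longleftrightarrow> \<gamma> \<in> {0<..<pi}" if "\<gamma> \<in> {0..<2 * pi}" for \<gamma>
        using pos[OF that] \<open>P \<in> K\<close> unfolding hitting_directions_def by auto
    qed auto
    then show ?thesis by (simp add: integral_half_turn)
  qed
  show "point_density K P
      = 2 * (2 * H (visual_angle1 K P) + 2 * H (visual_angle2 K P) - H (visual_angle K P))" if out: "P \<notin> K"
  proof -
    obtain m M where mM: "0 < m" "m < M" "M < pi"
      and gap: "\<And>\<gamma>. 0 < \<gamma> \<Longrightarrow> \<gamma> < pi \<Longrightarrow>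
        (\<exists>x\<in>K. height P (c + \<gamma>) \<le> height x (c + \<gamma>)) \<longleftrightarrow> \<gamma> \<notin> {m<..<M}"
      and v: "visual_angle1 K P = pi - M" "visual_angle2 K P = m"
      using missing_directions_interval[OF \<open>P \<noteq> 0\<close> P K out] by blast
    let ?B = "{0<..m} \<union> {M..<pi}"
    have "point_density K P = (LBINT z. indicator (?B \<times> ?B) z * kernel (snd z - fst z))"
    proof (rule point_density_rotated[OF K(1) c])
      show "c + \<gamma> \<in> hitting_directions K P \<longleftrightarrow> \<gamma> \<in> ?B" if "\<gamma> \<in> {0..<2 * pi}" for \<gamma>
        using pos[OF that] gap[of \<gamma>] mM unfolding hitting_directions_def by auto
    qed (use mM in auto)
    also have "\<dots> = 2 * (2 * H (pi - M) + 2 * H m - H (m + pi - M))"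
      using mM by (intro integral_two_arcs) auto
    finally show ?thesis by (simp add: v visual_angle_split algebra_simps)
  qed
qed

section \<open>Integration over the plane\<close>

text \<open>The coordinates of the lines that meet \<open>K\<close> lie in a compact rectangle, on which the integrand is
  continuous.\<close>

lemma integrable_line_pairs:
  assumes "compact K"
  shows "set_integrable lborel (lines_meeting K \<times> lines_meeting K) (\<lambda>z. f (snd (snd z) - snd (fst z)))"
proof -
  obtain B where B: "lines_meeting K \<subseteq> {0..B} \<times> {0..2 * pi}"
    using lines_meeting_bounded[OF compact_imp_bounded[OF assms]] .
  have "set_integrable lborel (({0..B} \<times> {0..2 * pi}) \<times> ({0..B} \<times> {0..2 * pi}))
      (\<lambda>z. f (snd (snd z) - snd (fst z)))"
    unfolding set_integrable_def
    by (intro borel_integrable_compact compact_Times compact_Icc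
        continuous_on_compose2[OF f_cont] continuous_intros) auto
  then show ?thesis
    by (rule set_integrable_subset) (use B in \<open>auto intro!: borel_Times lines_meeting_borel[OF assms]\<close>)
qed

lemma point_density_eq:
  assumes "convex K" "0 \<in> K"
  shows "(LBINT \<phi>. \<bar>sin (snd \<phi> - fst \<phi>)\<bar> * (\<lambda>z. indicator (lines_meeting K \<times> lines_meeting K) z
      *\<^sub>R f (snd (snd z) - snd (fst z))) (lines_through (P, \<phi>))) = point_density K P"
  unfolding point_density_def
  by (intro Bochner_Integration.integral_cong refl)
    (auto simp: lines_through_def split_beta indicator_times mem_lines_meeting_iff[OF assms] kernel_def indicator_def)

end

theorem proposition5:
  fixes K :: "(real^2) set" and F :: real
    and f :: "real \<Rightarrow> real" and H H1 H2 :: "real \<Rightarrow> real"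
  assumes "compact K" and "convex K"
    and "F = measure lborel K"
    and "C2_boundary K"
    and "0 \<in> interior K"
    and "continuous_on UNIV f"
    and "\<forall>x. f (x + pi) = - f x"
    and "\<forall>x. f (- x) = f x"
    and "C2_on {0..pi} H H1 H2"
    and "\<forall>x\<in>{0..pi}. H2 x = f x * sin x"
    and "H 0 = 0" and "H1 0 = 0"
  shows "set_integrable lborel (lines_meeting K \<times> lines_meeting K)
           (\<lambda>((p1, \<phi>1), (p2, \<phi>2)). f (\<phi>2 - \<phi>1)) \<and>
         set_integrable lborel (- K)
           (\<lambda>P. 2 * H (visual_angle1 K P) + 2 * H (visual_angle2 K P) - H (visual_angle K P)) \<and>
         (LINT ((p1, \<phi>1), (p2, \<phi>2)) : lines_meeting K \<times> lines_meeting K | lborel. f (\<phi>2 - \<phi>1))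
         = 2 * (4 * H (pi / 2) - H pi) * F
           + 2 * (LINT P : - K | lborel.
               2 * H (visual_angle1 K P) + 2 * H (visual_angle2 K P) - H (visual_angle K P))"
proof -
  interpret angle_kernel f H H1 H2
    by standard (use assms in auto)
  let ?V = "\<lambda>P. 2 * H (visual_angle1 K P) + 2 * H (visual_angle2 K P) - H (visual_angle K P)"
  let ?F = "\<lambda>z. indicator (lines_meeting K \<times> lines_meeting K) z *\<^sub>R f (snd (snd z) - snd (fst z))"
  note K = assms(1,2,5)
  have "0 \<in> K" using assms(5) interior_subset by blast
  have [measurable]: "K \<in> sets borel" using assms(1) by (simp add: compact_imp_closed)
  have int: "set_integrable lborel (lines_meeting K \<times> lines_meeting K) (\<lambda>z. f (snd (snd z) - snd (fst z)))"
    by (rule integrable_line_pairs[OF assms(1)])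
  note intF = int[unfolded set_integrable_def]
  note density = point_density_eq[OF assms(2) \<open>0 \<in> K\<close>]
  have D: "integrable lborel (point_density K)"
    using integrable_at_intersection[OF intF] unfolding density by simp
  have I: "integral\<^sup>L lborel ?F = integral\<^sup>L lborel (point_density K)"
    using integral_at_intersection[OF intF] unfolding density by simp
  have setD: "set_integrable lborel A (point_density K)" if "A \<in> sets borel" for A
    unfolding set_integrable_def using integrable_mult_indicator[OF _ D] that by simp
  have out: "point_density K P = 2 * ?V P" if "P \<in> - K" for P
  proof -
    have "P \<noteq> 0" using that \<open>0 \<in> K\<close> by auto
    then show ?thesis using that by (intro point_density_outside[OF K]) simp_all
  qed
  have "set_integrable lborel (- K) (\<lambda>P. (1 / 2) * point_density K P)"
    by (intro set_integrable_mult_right setD) simp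
  then have intV: "set_integrable lborel (- K) ?V"
    by (rule set_integrable_cong[THEN iffD1, rotated -1]) (simp_all add: out)
  have "(LINT P : - K | lborel. point_density K P) = (LINT P : - K | lborel. 2 * ?V P)"
    by (intro set_lebesgue_integral_cong) (auto simp: out)
  also have "\<dots> = 2 * (LINT P : - K | lborel. ?V P)"
    by (rule set_integral_mult_right)
  finally have outV: "(LINT P : - K | lborel. point_density K P) = 2 * (LINT P : - K | lborel. ?V P)" .
  have "(LINT P : K | lborel. point_density K P) = (LINT P : K | lborel. 2 * H pi)"
  proof (rule set_lebesgue_integral_cong_AE)
    show "AE P \<in> K in lborel. point_density K P = 2 * H pi"
      \<comment> \<open>The origin has to be excluded: the lines through it have no coordinates.\<close>
      using AE_lborel_singleton[of "0::real^2"]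
      by eventually_elim (use point_density_inside[OF K] in auto)
  qed (use D in auto)
  also have "\<dots> = 2 * H pi * F"
    using assms(1,3) by (simp add: set_lebesgue_integral_def mult.commute)
  finally have inV: "(LINT P : K | lborel. point_density K P) = 2 * H pi * F" .
  have "integral\<^sup>L lborel (point_density K) = (LINT P : K \<union> - K | lborel. point_density K P)"
    by (simp add: set_lebesgue_integral_def)
  also have "\<dots> = 2 * H pi * F + 2 * (LINT P : - K | lborel. ?V P)"
    unfolding inV[symmetric] outV[symmetric] by (intro set_integral_Un setD) auto
  also have "H pi = 4 * H (pi / 2) - H pi"
    using H_reflect[of "pi / 2"] by simp
  finally have "(LINT z : lines_meeting K \<times> lines_meeting K | lborel. f (snd (snd z) - snd (fst z)))
      = 2 * (4 * H (pi / 2) - H pi) * F + 2 * (LINT P : - K | lborel. ?V P)"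
    unfolding set_lebesgue_integral_def[of lborel "lines_meeting K \<times> lines_meeting K"] I .
  then show ?thesis using int intV by (simp add: case_prod_unfold)
qed

end
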